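(* Let $q>r\geq1$ be integers. The commutator subgroup $F_{q,r}'$ of the Higman--Thompson group $F_{q,r}$ is isomorphic to the commutator subgroup $(\mathrm{B}F_q)'$ of $\mathrm{B}F_q$; it is $6$-uniformly simple, and its commutator width is at most two.
   Context: Let $q>r\geq 1$ be integers. $F_{q,r}$ (respectively $F_q$) is the group of order preserving, piecewise affine (with finitely many pieces) bijections of $(0,r)\cap\mathbf Z[1/q]$ (respectively of $\mathbf Z[1/q]$) whose breaking points belong to $\mathbf Z[1/q]$ and whose slopes are of the form $q^k$, $k\in\mathbf Z$. $\mathrm{B}F_q$ is the subgroup of $F_q$ consisting of the transformations $\gamma$ whose support $\{x:\gamma(x)\ne x\}$ is contained in an interval $(x,y)$ for some $x,y\in\mathbf Z[1/q]$. A group $G$ is called $N$-uniformly simple if for every nontrivial $f\in G$ and every nontrivial conjugacy class $C\subset G$, the element $f$ is a product of at most $N$ elements of $C^{\pm1}=C\cup C^{-1}$. The commutator length of an element of $[G,G]$ is the minimal number of commutators of elements of $G$ whose product it is; the commutator width of $G$ is the maximum of the commutator lengths of the elements of $[G,G]$. *)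

theory Defs
  imports "HOL-Analysis.Analysis" "HOL-Algebra.Algebra" "HOL-Library.Extended_Nat"
begin

section \<open>Uniform simplicity and commutator width\<close>

definition list_prod :: "('a, 'b) monoid_scheme \<Rightarrow> 'a list \<Rightarrow> 'a" where
  "list_prod G gs = foldr (\<otimes>\<^bsub>G\<^esub>) gs \<one>\<^bsub>G\<^esub>"

definition conjugacy_class :: "('a, 'b) monoid_scheme \<Rightarrow> 'a \<Rightarrow> 'a set" where
  "conjugacy_class G g = {h \<otimes>\<^bsub>G\<^esub> g \<otimes>\<^bsub>G\<^esub> inv\<^bsub>G\<^esub> h | h. h \<in> carrier G}"

definition uniformly_simple :: "nat \<Rightarrow> ('a, 'b) monoid_scheme \<Rightarrow> bool" where
  "uniformly_simple N G \<longleftrightarrow> group G \<and>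
     (\<forall>f \<in> carrier G - {\<one>\<^bsub>G\<^esub>}.
      \<forall>C \<in> conjugacy_class G ` carrier G - {{\<one>\<^bsub>G\<^esub>}}.
        \<exists>gs. length gs \<le> N \<and> set gs \<subseteq> C \<union> m_inv G ` C \<and> f = list_prod G gs)"

definition commutator_subgroup :: "('a, 'b) monoid_scheme \<Rightarrow> ('a, 'b) monoid_scheme" where
  "commutator_subgroup G = G\<lparr>carrier := derived G (carrier G)\<rparr>"

definition commutator_length :: "('a, 'b) monoid_scheme \<Rightarrow> 'a \<Rightarrow> enat" where
  "commutator_length G g =
     (INF cs \<in> {cs. set cs \<subseteq> derived_set G (carrier G) \<and> list_prod G cs = g}. enat (length cs))"

text \<open>The maximum of the commutator lengths; the value is \<open>\<infinity>\<close> if they are unbounded.\<close>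

definition commutator_width :: "('a, 'b) monoid_scheme \<Rightarrow> enat" where
  "commutator_width G = (SUP g \<in> derived G (carrier G). commutator_length G g)"

section \<open>Higman--Thompson groups\<close>

definition Z_inverse :: "nat \<Rightarrow> real set" where
  "Z_inverse q = {of_int a / of_nat q ^ n | (a::int) (n::nat). True}"

text \<open>
  The finite set \<open>B\<close> contains the breaking points of \<open>f\<close>. The pieces are the traces on \<open>S\<close> of
  the intervals that avoid \<open>B\<close>. Points of \<open>B \<inter> S\<close> need no condition of their own: an order
  preserving bijection of \<open>S\<close> is determined at such a point by its values nearby, as \<open>S\<close> will be
  dense in an open interval.
\<close>

definition piecewise_affine :: "nat \<Rightarrow> real set \<Rightarrow> (real \<Rightarrow> real) \<Rightarrow> bool" where
  "piecewise_affine q S f \<longleftrightarrow>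
     (\<exists>B. finite B \<and> B \<subseteq> Z_inverse q \<and>
        (\<forall>I. is_interval I \<and> I \<inter> B = {} \<longrightarrow>
           (\<exists>(k::int) (c::real). \<forall>x \<in> S \<inter> I. f x = of_nat q powi k * x + c)))"

definition PA_group :: "nat \<Rightarrow> real set \<Rightarrow> (real \<Rightarrow> real) monoid" where
  "PA_group q S =
     (BijGroup S)\<lparr>carrier := {f \<in> Bij S. strict_mono_on S f \<and> piecewise_affine q S f}\<rparr>"

definition F_interval :: "nat \<Rightarrow> nat \<Rightarrow> (real \<Rightarrow> real) monoid" where
  "F_interval q r = PA_group q ({0<..<of_nat r} \<inter> Z_inverse q)"

definition F_line :: "nat \<Rightarrow> (real \<Rightarrow> real) monoid" where
  "F_line q = PA_group q (Z_inverse q)"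

definition BF :: "nat \<Rightarrow> (real \<Rightarrow> real) monoid" where
  "BF q = (F_line q)\<lparr>carrier := {g \<in> carrier (F_line q).
     \<exists>x \<in> Z_inverse q. \<exists>y \<in> Z_inverse q. {t \<in> Z_inverse q. g t \<noteq> t} \<subseteq> {x<..<y}}\<rparr>"

end

theory Submission
  imports Defs
begin

text \<open>
  Everything follows from the way the boundedly supported elements move intervals. Every element of
  the commutator subgroup is a product of commutators whose entries are supported in one bounded
  interval \<open>J\<close>. If \<open>t\<close> pushes \<open>J\<close> off itself, then the successive translates of \<open>J\<close> under \<open>t\<close> are
  disjoint, and the product can be rewritten as \<open>[A, B] [F, t]\<close>. By proximality this can be done
  inside the commutator subgroup, with \<open>t\<close> a given nontrivial element after a conjugation; then
  \<open>[F, t]\<close> is a product of two conjugates of \<open>t\<close> and its inverse, and \<open>[A, B]\<close> of four.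

  A locally finite piecewise affine bijection between the interval and the line identifies the two
  groups of boundedly supported elements. Finally, an element of the group of the interval agrees
  near the end points with powers of two commuting contractions supported near 0 and near \<open>r\<close>. By
  shrinking these supports one sees that a commutator of two arbitrary elements is already a product
  of commutators of boundedly supported ones.
\<close>

section \<open>Commutators\<close>

text \<open>Since q^k is congruent to 1 modulo q - 1, every element of \<open>BF q\<close> preserves
  the classes of Z[1/q] modulo (q - 1) Z[1/q]. For q > 2 the action is therefore not transitive, and
  an interval cannot in general be carried onto another one with prescribed end points. This is why
  proximality only asks that an interval can be moved strictly inside another. It also explains the
  length q - 1 of the pieces in the passage from the line to the interval: two consecutive powers
  q^-(m+1) and q^-m differ by (q - 1) q^-(m+1).

  The theorem treats the commutator subgroup as a group in its own right, so conjugators and entries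
  of commutators must lie in it again. Hence the general argument is made for perfect groups, and
  the commutator subgroup is shown to be perfect and to inherit the proximal action.

  In the group of the interval, slopes at an end point multiply, so a commutator of arbitrary
  elements has bounded support at once. The real task is to write it as a product of commutators
  whose entries have bounded support.\<close>

context group
begin

definition comm :: "'a \<Rightarrow> 'a \<Rightarrow> 'a" where
  "comm a b = a \<otimes> b \<otimes> inv a \<otimes> inv b"

lemma comm_closed [simp, intro]:
  "a \<in> carrier G \<Longrightarrow> b \<in> carrier G \<Longrightarrow> comm a b \<in> carrier G"
  by (simp add: comm_def)

lemma mult_inv_cancel [simp]:
  "x \<in> carrier G \<Longrightarrow> y \<in> carrier G \<Longrightarrow> x \<otimes> (inv x \<otimes> y) = y"
  "x \<in> carrier G \<Longrightarrow> y \<in> carrier G \<Longrightarrow> inv x \<otimes> (x \<otimes> y) = y"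
  by (simp_all flip: m_assoc)

lemma commute_inv:
  assumes "x \<otimes> y = y \<otimes> x" "x \<in> carrier G" "y \<in> carrier G"
  shows "inv x \<otimes> y = y \<otimes> inv x"
proof -
  have "inv x \<otimes> y = inv x \<otimes> (y \<otimes> x) \<otimes> inv x"
    using assms(2,3) by (simp add: m_assoc)
  also have "\<dots> = inv x \<otimes> (x \<otimes> y) \<otimes> inv x"
    by (simp only: assms(1))
  also have "\<dots> = y \<otimes> inv x"
    using assms(2,3) by simp
  finally show ?thesis .
qed

lemma commute_inv_inv:
  assumes "x \<otimes> y = y \<otimes> x" "x \<in> carrier G" "y \<in> carrier G"
  shows "inv x \<otimes> inv y = inv y \<otimes> inv x"
  using assms(2,3) by (simp add: assms(1) flip: inv_mult_group)

lemma comm_eq_one: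
  assumes "x \<otimes> y = y \<otimes> x" "x \<in> carrier G" "y \<in> carrier G"
  shows "comm x y = \<one>"
  using assms(2,3) by (simp add: comm_def assms(1) m_assoc)

lemma comm_inv:
  assumes "a \<in> carrier G" "b \<in> carrier G"
  shows "inv (comm a b) = comm b a"
  using assms by (simp add: comm_def inv_mult_group m_assoc)

lemma conj_mult:
  assumes "h \<in> carrier G" "a \<in> carrier G" "b \<in> carrier G"
  shows "h \<otimes> (a \<otimes> b) \<otimes> inv h = (h \<otimes> a \<otimes> inv h) \<otimes> (h \<otimes> b \<otimes> inv h)"
  using assms by (simp add: m_assoc)

lemma conj_inv:
  assumes "h \<in> carrier G" "a \<in> carrier G"
  shows "h \<otimes> inv a \<otimes> inv h = inv (h \<otimes> a \<otimes> inv h)"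
  using assms by (simp add: inv_mult_group m_assoc)

lemma conj_conj:
  assumes "h \<in> carrier G" "k \<in> carrier G" "a \<in> carrier G"
  shows "h \<otimes> (k \<otimes> a \<otimes> inv k) \<otimes> inv h = (h \<otimes> k) \<otimes> a \<otimes> inv (h \<otimes> k)"
  using assms by (simp add: inv_mult_group m_assoc)

lemma conj_comm:
  assumes "h \<in> carrier G" "a \<in> carrier G" "b \<in> carrier G"
  shows "h \<otimes> comm a b \<otimes> inv h = comm (h \<otimes> a \<otimes> inv h) (h \<otimes> b \<otimes> inv h)"
  using assms by (simp add: comm_def inv_mult_group m_assoc)

lemma comm_mult_left:
  assumes "x \<in> carrier G" "y \<in> carrier G" "z \<in> carrier G"
  shows "comm (x \<otimes> y) z = (x \<otimes> comm y z \<otimes> inv x) \<otimes> comm x z"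
  using assms by (simp add: comm_def inv_mult_group m_assoc)

lemma comm_mult_right:
  assumes "x \<in> carrier G" "y \<in> carrier G" "z \<in> carrier G"
  shows "comm x (y \<otimes> z) = comm x y \<otimes> (y \<otimes> comm x z \<otimes> inv y)"
  using assms by (simp add: comm_def inv_mult_group m_assoc)

lemma comm_mult_commuting:
  assumes "a \<in> carrier G" "b \<in> carrier G" "c \<in> carrier G" "d \<in> carrier G"
    and "a \<otimes> c = c \<otimes> a" "a \<otimes> d = d \<otimes> a" "b \<otimes> c = c \<otimes> b" "b \<otimes> d = d \<otimes> b"
  shows "comm (a \<otimes> c) (b \<otimes> d) = comm a b \<otimes> comm c d"
proof -
  \<comment> \<open>As rewrite rules these move \<open>a\<close>, \<open>b\<close> and their
    inverses to the left of \<open>c\<close>, \<open>d\<close> and theirs; the second form reaches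
    into products associated to the right.\<close>
  have swap: "v \<otimes> u = u \<otimes> v"
      "u \<in> carrier G \<Longrightarrow> v \<in> carrier G \<Longrightarrow> z \<in> carrier G \<Longrightarrow> v \<otimes> (u \<otimes> z) = u \<otimes> (v \<otimes> z)"
    if "u \<otimes> v = v \<otimes> u" for u v z
    using that by (simp_all flip: m_assoc)
  note i = assms(5-8)[THEN commute_inv]
  note j = assms(5-8)[symmetric, THEN commute_inv, symmetric]
  note k = assms(5-8)[THEN commute_inv_inv]
  show ?thesis
    using assms(1-4)
    by (simp add: comm_def inv_mult_group m_assoc assms(5-8)[THEN swap(1)] assms(5-8)[THEN swap(2)]
        i[THEN swap(1)] i[THEN swap(2)] j[THEN swap(1)] j[THEN swap(2)] k[THEN swap(1)] k[THEN swap(2)])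
qed

lemma derived_set_eq_comm: "derived_set G H = {comm a b | a b. a \<in> H \<and> b \<in> H}"
  by (auto simp: comm_def)

lemma comm_in_derived: "a \<in> H \<Longrightarrow> b \<in> H \<Longrightarrow> comm a b \<in> derived G H"
  unfolding derived_def derived_set_eq_comm by (rule generate.incl) auto

text \<open>
  Here \<open>B\<close> is central modulo its own derived subgroup, by the first hypothesis on \<open>B\<close>, and the
  carrier is the product of \<open>B\<close> with a commutative set.
\<close>

lemma derived_eq_derived_subgroup:
  assumes B: "subgroup B G"
    and centralize: "\<And>f b. f \<in> carrier G \<Longrightarrow> b \<in> B \<Longrightarrow>
      \<exists>h \<in> carrier G. h \<otimes> b = b \<otimes> h \<and> f \<otimes> h \<in> B"
    and H: "H \<subseteq> carrier G" "\<And>h k. h \<in> H \<Longrightarrow> k \<in> H \<Longrightarrow> h \<otimes> k = k \<otimes> h"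
    and factor: "\<And>f. f \<in> carrier G \<Longrightarrow> \<exists>h \<in> H. f \<otimes> h \<in> B"
  shows "derived G (carrier G) = derived G B"
proof
  have Bc: "b \<in> carrier G" if "b \<in> B" for b
    using B that by (rule subgroup.mem_carrier)
  interpret N: subgroup "derived G B" G
    using derived_is_subgroup[OF subgroup.subset[OF B]] .
  have NB: "derived G B \<subseteq> B"
    by (rule derived_incl[OF order.refl B])
  \<comment> \<open>As \<open>h\<close> commutes with \<open>b\<close>, replacing \<open>f\<close>
    by \<open>f \<otimes> h\<close> does not change the commutator with \<open>b\<close>, and it
    brings the first entry into \<open>B\<close>.\<close>
  have FB: "comm f b \<in> derived G B" if f: "f \<in> carrier G" and b: "b \<in> B" for f b
  proof -
    obtain h where h: "h \<in> carrier G" "h \<otimes> b = b \<otimes> h" "f \<otimes> h \<in> B"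
      using centralize[OF f b] by blast
    have "comm f b = comm (f \<otimes> h \<otimes> inv h) b"
      using f h by (simp add: m_assoc)
    also have "\<dots> = comm (f \<otimes> h) b"
      using f h Bc[OF b] comm_eq_one[of "inv h" b] commute_inv[of h b]
      by (subst comm_mult_left) auto
    finally show ?thesis
      using comm_in_derived[OF h(3) b] by simp
  qed
  have BF: "comm b f \<in> derived G B" if "f \<in> carrier G" "b \<in> B" for f b
    using N.m_inv_closed[OF FB[OF that]] comm_inv that Bc by simp
  have conj: "f \<otimes> n \<otimes> inv f \<in> derived G B" if f: "f \<in> carrier G" and n: "n \<in> derived G B" for f n
  proof -
    have "f \<otimes> n \<otimes> inv f = comm f n \<otimes> n"
      using f n by (simp add: comm_def m_assoc)
    then show ?thesis
      using FB[OF f] n NB by auto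
  qed
  \<comment> \<open>Both entries are factored through \<open>B\<close>. The commuting factors left
    over contribute only \<open>comm (inv h) (inv k)\<close>, which is trivial, so that commutators
    with an entry in \<open>B\<close>, up to conjugation, are all that remains.\<close>
  have "comm f g \<in> derived G B" if f: "f \<in> carrier G" and g: "g \<in> carrier G" for f g
  proof -
    obtain h k where h: "h \<in> H" "f \<otimes> h \<in> B" and k: "k \<in> H" "g \<otimes> k \<in> B"
      using factor f g by meson
    have hk: "h \<in> carrier G" "k \<in> carrier G"
      using h k H(1) by auto
    have 1: "comm (inv h) (inv k) = \<one>"
      using hk H(2)[OF h(1) k(1)] by (intro comm_eq_one commute_inv_inv) auto
    have gk: "g = (g \<otimes> k) \<otimes> inv k" and fh: "f = (f \<otimes> h) \<otimes> inv h"
      using f g hk by (simp_all add: m_assoc)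
    have "comm (inv h) g = comm (inv h) (g \<otimes> k) \<otimes> ((g \<otimes> k) \<otimes> comm (inv h) (inv k) \<otimes> inv (g \<otimes> k))"
      using hk g by (subst gk, subst comm_mult_right) auto
    also have "\<dots> = comm (inv h) (g \<otimes> k)"
      using hk g 1 by simp
    finally have 2: "comm (inv h) g \<in> derived G B"
      using FB[of "inv h" "g \<otimes> k"] hk k by simp
    have "comm f g = ((f \<otimes> h) \<otimes> comm (inv h) g \<otimes> inv (f \<otimes> h)) \<otimes> comm (f \<otimes> h) g"
      using hk f g by (subst fh, subst comm_mult_left) auto
    then show ?thesis
      using conj[OF _ 2, of "f \<otimes> h"] BF[OF g h(2)] hk f by simp
  qed
  then show "derived G (carrier G) \<subseteq> derived G B"
    unfolding derived_def[of G "carrier G"] derived_set_eq_comm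
    by (intro generate_subgroup_incl N.subgroup_axioms) auto
  show "derived G B \<subseteq> derived G (carrier G)"
    by (rule mono_derived[OF subgroup.subset[OF B]])
qed

end

lemma commutator_subgroup_iso:
  assumes "group G" "group H" "h \<in> iso G H"
  shows "commutator_subgroup G \<cong> commutator_subgroup H"
proof -
  interpret G: group G by fact
  interpret H: group H by fact
  have hom: "h \<in> hom G H" and bij: "bij_betw h (carrier G) (carrier H)"
    using assms(3) by (auto simp: iso_def)
  interpret group_hom G H h
    by unfold_locales (fact hom)
  have img: "h ` derived G (carrier G) = derived H (carrier H)"
    using derived_img[of "carrier G"] bij by (simp add: bij_betw_def)
  have sub: "derived G (carrier G) \<subseteq> carrier G"
    by (rule G.derived_in_carrier) simp
  have "bij_betw h (derived G (carrier G)) (derived H (carrier H))"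
    using bij_betw_subset[OF bij sub img] .
  moreover have "h \<in> hom (commutator_subgroup G) (commutator_subgroup H)"
    using sub img hom_mult by (auto simp: hom_def subset_iff commutator_subgroup_def)
  ultimately show ?thesis
    by (auto simp: is_iso_def iso_def commutator_subgroup_def)
qed

section \<open>Bounded proximal actions on linear orders\<close>

text \<open>The action is a parameter separate from the group, so that it can be transported along
  an isomorphism of groups. In \<open>bounded\<close> the interval is nondegenerate even for the
  identity, so every element comes with an interval to which \<open>proximal\<close>
  applies.\<close>

locale proximal_action = group G for G (structure) +
  fixes \<Omega> :: "'x::linorder set" and act :: "'a \<Rightarrow> 'x \<Rightarrow> 'x"
  assumes act_closed: "g \<in> carrier G \<Longrightarrow> x \<in> \<Omega> \<Longrightarrow> act g x \<in> \<Omega>"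
    and act_mult: "g \<in> carrier G \<Longrightarrow> h \<in> carrier G \<Longrightarrow> x \<in> \<Omega> \<Longrightarrow> act (g \<otimes> h) x = act g (act h x)"
    and faithful: "g \<in> carrier G \<Longrightarrow> (\<And>x. x \<in> \<Omega> \<Longrightarrow> act g x = x) \<Longrightarrow> g = \<one>"
    and act_less: "g \<in> carrier G \<Longrightarrow> x \<in> \<Omega> \<Longrightarrow> y \<in> \<Omega> \<Longrightarrow> x < y \<Longrightarrow> act g x < act g y"
    and bounded: "g \<in> carrier G \<Longrightarrow>
      \<exists>a\<in>\<Omega>. \<exists>b\<in>\<Omega>. a < b \<and> (\<forall>x\<in>\<Omega>. act g x \<noteq> x \<longrightarrow> a < x \<and> x < b)"
    and proximal: "a \<in> \<Omega> \<Longrightarrow> b \<in> \<Omega> \<Longrightarrow> c \<in> \<Omega> \<Longrightarrow> d \<in> \<Omega> \<Longrightarrow> a < b \<Longrightarrow> c < d \<Longrightarrow>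
      \<exists>g\<in>carrier G. c < act g a \<and> act g b < d"
begin

lemma act_less_iff:
  assumes "g \<in> carrier G" "x \<in> \<Omega>" "y \<in> \<Omega>"
  shows "act g x < act g y \<longleftrightarrow> x < y"
  using act_less[OF assms] act_less[OF assms(1,3,2)] by (metis less_asym less_irrefl neq_iff)

lemma act_eq_iff:
  assumes "g \<in> carrier G" "x \<in> \<Omega>" "y \<in> \<Omega>"
  shows "act g x = act g y \<longleftrightarrow> x = y"
  using act_less[OF assms] act_less[OF assms(1,3,2)] by (metis less_irrefl neq_iff)

text \<open>The action of \<open>\<one>\<close> is idempotent and, being strictly monotone on a
  linear order, injective.\<close>

lemma act_one:
  assumes "x \<in> \<Omega>"
  shows "act \<one> x = x"
proof -
  have "act \<one> (act \<one> x) = act \<one> x"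
    using act_mult[of \<one> \<one> x] assms by simp
  then show ?thesis
    using act_eq_iff[of \<one> "act \<one> x" x] act_closed assms by simp
qed

lemma act_inv:
  assumes "g \<in> carrier G" "x \<in> \<Omega>"
  shows "act (inv g) (act g x) = x" "act g (act (inv g) x) = x"
  using assms act_mult[of "inv g" g x] act_mult[of g "inv g" x] act_one by simp_all

lemma faithful_eq:
  assumes "g \<in> carrier G" "h \<in> carrier G" "\<And>x. x \<in> \<Omega> \<Longrightarrow> act g x = act h x"
  shows "g = h"
proof -
  have "g \<otimes> inv h = \<one>"
    using assms by (intro faithful) (simp_all add: act_mult act_closed act_inv)
  then show ?thesis
    using assms(1,2) inv_equality by fastforce
qed

section \<open>Rigid stabilizers and displacement of intervals\<close>

definition rist :: "'x set \<Rightarrow> 'a set" where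
  "rist U = {g \<in> carrier G. \<forall>x \<in> \<Omega> - U. act g x = x}"

lemma rist_carrier: "g \<in> rist U \<Longrightarrow> g \<in> carrier G"
  by (simp add: rist_def)

lemma rist_fixes: "g \<in> rist U \<Longrightarrow> x \<in> \<Omega> \<Longrightarrow> x \<notin> U \<Longrightarrow> act g x = x"
  by (simp add: rist_def)

lemma rist_mono: "U \<subseteq> V \<Longrightarrow> rist U \<subseteq> rist V"
  by (auto simp: rist_def)

lemma rist_interval_mono: "g \<in> rist {a<..<b} \<Longrightarrow> c \<le> a \<Longrightarrow> b \<le> d \<Longrightarrow> g \<in> rist {c<..<d}"
  using rist_mono[of "{a<..<b}" "{c<..<d}"] by (force intro: le_less_trans less_le_trans)

lemma rist_one: "\<one> \<in> rist U"
  by (simp add: rist_def act_one)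

lemma rist_mult: "g \<in> rist U \<Longrightarrow> h \<in> rist U \<Longrightarrow> g \<otimes> h \<in> rist U"
  by (simp add: rist_def act_mult)

lemma rist_inv:
  assumes "g \<in> rist U"
  shows "inv g \<in> rist U"
proof -
  have "act (inv g) x = x" if "x \<in> \<Omega>" "x \<notin> U" for x
    using act_inv(1)[of g x] rist_fixes[OF assms that] rist_carrier[OF assms] that by simp
  then show ?thesis
    using rist_carrier[OF assms] by (simp add: rist_def)
qed

lemma rist_comm: "g \<in> rist U \<Longrightarrow> h \<in> rist U \<Longrightarrow> comm g h \<in> rist U"
  by (simp add: comm_def rist_mult rist_inv)

lemma rist_conj:
  assumes "g \<in> rist U" "h \<in> carrier G" "\<And>x. x \<in> \<Omega> \<Longrightarrow> x \<in> U \<Longrightarrow> act h x \<in> V"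
  shows "h \<otimes> g \<otimes> inv h \<in> rist V"
proof -
  have g: "g \<in> carrier G"
    using assms(1) by (rule rist_carrier)
  have "act (h \<otimes> g \<otimes> inv h) y = y" if y: "y \<in> \<Omega>" "y \<notin> V" for y
  proof -
    have "act (inv h) y \<notin> U"
      using assms(2) assms(3)[of "act (inv h) y"] act_inv(2)[of h y] y act_closed[of "inv h" y] by auto
    then have "act g (act (inv h) y) = act (inv h) y"
      using rist_fixes[OF assms(1)] act_closed y assms(2) by simp
    then show ?thesis
      using assms(2) g y by (simp add: act_mult act_closed act_inv)
  qed
  then show ?thesis
    using assms(2) g by (simp add: rist_def)
qed

lemma rist_commute:
  assumes "g \<in> rist U" "h \<in> rist V" "U \<inter> V = {}"
  shows "g \<otimes> h = h \<otimes> g"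
proof (rule faithful_eq)
  show gh: "g \<otimes> h \<in> carrier G" "h \<otimes> g \<in> carrier G"
    using assms by (auto dest: rist_carrier)
  fix x assume x: "x \<in> \<Omega>"
  \<comment> \<open>By injectivity the image of a moved point is moved as well, so it cannot leave
    \<open>W\<close>.\<close>
  have mv: "act k y \<in> W" if "k \<in> rist W" "y \<in> \<Omega>" "act k y \<noteq> y" for k W y
    using that act_eq_iff[of k "act k y" y] rist_fixes[OF that(1), of "act k y"] rist_carrier act_closed
    by blast
  have g: "g \<in> carrier G" and h: "h \<in> carrier G"
    using assms by (auto dest: rist_carrier)
  consider "act g x \<noteq> x" | "act h x \<noteq> x" | "act g x = x" "act h x = x"
    by blast
  then have "act g (act h x) = act h (act g x)"
  proof cases
    case 1
    then have "x \<in> U" "act g x \<in> U"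
      using mv[OF assms(1) x] rist_fixes[OF assms(1) x] by auto
    then have "x \<notin> V" "act g x \<notin> V"
      using assms(3) by auto
    then show ?thesis
      using rist_fixes[OF assms(2)] x act_closed[OF g x] by simp
  next
    case 2
    then have "x \<in> V" "act h x \<in> V"
      using mv[OF assms(2) x] rist_fixes[OF assms(2) x] by auto
    then have "x \<notin> U" "act h x \<notin> U"
      using assms(3) by auto
    then show ?thesis
      using rist_fixes[OF assms(1)] x act_closed[OF h x] by simp
  qed simp
  then show "act (g \<otimes> h) x = act (h \<otimes> g) x"
    using g h x by (simp add: act_mult)
qed

lemma common_interval:
  assumes "finite S" "S \<subseteq> carrier G"
  shows "\<exists>a\<in>\<Omega>. \<exists>b\<in>\<Omega>. a < b \<and> S \<subseteq> rist {a<..<b}"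
  using assms
proof (induction S rule: finite_induct)
  case empty
  then show ?case
    using bounded[of \<one>] by auto
next
  case (insert g S)
  then obtain a b where ab: "a \<in> \<Omega>" "b \<in> \<Omega>" "a < b" "S \<subseteq> rist {a<..<b}"
    by blast
  obtain c d where cd: "c \<in> \<Omega>" "d \<in> \<Omega>" "c < d" "\<And>x. x \<in> \<Omega> \<Longrightarrow> act g x \<noteq> x \<Longrightarrow> c < x \<and> x < d"
    using bounded[of g] insert.prems by auto
  have "g \<in> rist {min a c<..<max b d}"
    using insert.prems cd by (force simp: rist_def min_less_iff_disj less_max_iff_disj)
  moreover have "S \<subseteq> rist {min a c<..<max b d}"
    using ab(4) rist_interval_mono[of _ a b "min a c" "max b d"] by auto
  moreover have "min a c \<in> \<Omega>" "max b d \<in> \<Omega>" "min a c < max b d"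
    using ab cd by (auto simp: min_def max_def)
  ultimately show ?case
    by blast
qed

text \<open>Proximality needs a target interval above \<open>b\<close>, and no point above
  \<open>b\<close> is given. One is made: an element that pushes \<open>b\<close> down has an
  inverse that pushes \<open>b\<close> up, which yields the target between \<open>b\<close> and
  \<open>act (inv g) b\<close>.\<close>

lemma displace:
  assumes "a \<in> \<Omega>" "b \<in> \<Omega>" "a < b"
  shows "\<exists>t\<in>carrier G. b < act t a"
proof -
  obtain g where g: "g \<in> carrier G" "act g b < b"
    using proximal[of a b a b] assms by blast
  then have "b < act (inv g) b"
    using assms act_less_iff[of g b "act (inv g) b"] act_inv(2)[of g b] act_closed by simp
  then show ?thesis
    using proximal[of a b b "act (inv g) b"] assms g act_closed by (metis inv_closed)
qed

text \<open>
  Replacing \<open>a\<close> and \<open>b\<close> by \<open>comm a u\<close> and \<open>comm b v\<close>, for \<open>u\<close> and \<open>v\<close> that move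
  the supports far away, does not change their commutator.
\<close>

lemma comm_in_second_derived:
  assumes "a \<in> carrier G" "b \<in> carrier G"
  shows "\<exists>a'\<in>derived G (carrier G). \<exists>b'\<in>derived G (carrier G). comm a b = comm a' b'"
proof -
  obtain x y where xy: "x \<in> \<Omega>" "y \<in> \<Omega>" "x < y" and ab: "a \<in> rist {x<..<y}" "b \<in> rist {x<..<y}"
    using common_interval[of "{a, b}"] assms by auto
  obtain u where u: "u \<in> carrier G" "y < act u x"
    using displace xy by blast
  have uxy: "act u x \<in> \<Omega>" "act u y \<in> \<Omega>" "x < act u y"
    using u xy act_closed act_less[of u x y] by auto
  \<comment> \<open>\<open>v\<close> clears the \<open>u\<close>-translate too, so that
    \<open>a'\<close> and \<open>b'\<close> commute with each other and not only with
    \<open>a\<close> and \<open>b\<close>.\<close>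
  obtain v where v: "v \<in> carrier G" "act u y < act v x"
    using displace[of x "act u y"] xy uxy by blast
  define a' where "a' = u \<otimes> inv a \<otimes> inv u"
  define b' where "b' = v \<otimes> inv b \<otimes> inv v"
  have a': "a' \<in> rist {act u x<..<act u y}"
    unfolding a'_def using u xy by (intro rist_conj[OF rist_inv[OF ab(1)]]) (auto simp: act_less)
  have b': "b' \<in> rist {act v x<..<act v y}"
    unfolding b'_def using v xy by (intro rist_conj[OF rist_inv[OF ab(2)]]) (auto simp: act_less)
  have car: "a' \<in> carrier G" "b' \<in> carrier G"
    using a' b' by (auto dest: rist_carrier)
  have c1: "a \<otimes> a' = a' \<otimes> a" "b \<otimes> a' = a' \<otimes> b"
    using u by (auto intro!: rist_commute[OF ab(1) a'] rist_commute[OF ab(2) a'])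
  have yv: "y < act v x"
    using u v uxy xy act_less[of u x y] by (meson order.strict_trans)
  have c2: "a \<otimes> b' = b' \<otimes> a" "b \<otimes> b' = b' \<otimes> b" "a' \<otimes> b' = b' \<otimes> a'"
    using yv v by (auto intro!: rist_commute[OF ab(1) b'] rist_commute[OF ab(2) b'] rist_commute[OF a' b'])
  have "comm a u = a \<otimes> a'" "comm b v = b \<otimes> b'"
    using assms u v by (simp_all add: comm_def a'_def b'_def m_assoc)
  then have "comm (comm a u) (comm b v) = comm a b"
    using comm_mult_commuting[OF assms car c1(1) c2(1) c1(2) c2(2)] comm_eq_one[OF c2(3) car]
      assms by simp
  then show ?thesis
    using comm_in_derived assms u v by metis
qed

section \<open>The commutator subgroup is perfect and proximal\<close>

lemma derived_derived: "derived G (derived G (carrier G)) = derived G (carrier G)"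
proof
  have D: "subgroup (derived G (carrier G)) G"
    by (simp add: derived_is_subgroup)
  show "derived G (derived G (carrier G)) \<subseteq> derived G (carrier G)"
    by (rule derived_incl[OF order.refl D])
  have "comm a b \<in> derived G (derived G (carrier G))" if "a \<in> carrier G" "b \<in> carrier G" for a b
    using comm_in_second_derived[OF that] comm_in_derived by metis
  then have "derived_set G (carrier G) \<subseteq> derived G (derived G (carrier G))"
    unfolding derived_set_eq_comm by blast
  then have "generate G (derived_set G (carrier G)) \<subseteq> derived G (derived G (carrier G))"
    by (rule generate_subgroup_incl) (rule derived_is_subgroup[OF subgroup.subset[OF D]])
  then show "derived G (carrier G) \<subseteq> derived G (derived G (carrier G))"
    by (simp only: derived_def[of G "carrier G"])
qed

text \<open>In \<open>comm g u\<close>, which is \<open>g\<close> times a conjugate of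
  \<open>inv g\<close>, the second factor is supported beyond the interval in question once
  \<open>u\<close> displaces far enough. Hence the commutator agrees with \<open>g\<close> at
  \<open>a\<close> and \<open>b\<close>.\<close>

lemma derived_proximal:
  assumes "a \<in> \<Omega>" "b \<in> \<Omega>" "c \<in> \<Omega>" "d \<in> \<Omega>" "a < b" "c < d"
  shows "\<exists>g\<in>derived G (carrier G). c < act g a \<and> act g b < d"
proof -
  obtain g where g: "g \<in> carrier G" "c < act g a" "act g b < d"
    using proximal[OF assms] by blast
  obtain x y where xy: "x \<in> \<Omega>" "y \<in> \<Omega>" "x < y" "g \<in> rist {x<..<y}"
    using common_interval[of "{g}"] g by auto
  define x' where "x' = min a x"
  define y' where "y' = max b y"
  have xy': "x' \<in> \<Omega>" "y' \<in> \<Omega>" "x' < y'" "x' \<le> a" "b \<le> y'"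
    using xy assms by (auto simp: x'_def y'_def min_def max_def)
  have gr: "g \<in> rist {x'<..<y'}"
    using xy(4) by (rule rist_interval_mono) (auto simp: x'_def y'_def)
  obtain u where u: "u \<in> carrier G" "y' < act u x'"
    using displace xy' by blast
  have r: "u \<otimes> inv g \<otimes> inv u \<in> rist {act u x'<..<act u y'}"
    using u xy' by (intro rist_conj[OF rist_inv[OF gr]]) (auto simp: act_less)
  have "act (comm g u) z = act g z" if z: "z \<in> \<Omega>" "z \<le> y'" for z
  proof -
    have "act (u \<otimes> inv g \<otimes> inv u) z = z"
      using u z by (intro rist_fixes[OF r]) auto
    then show ?thesis
      using g u z act_mult[of g "u \<otimes> inv g \<otimes> inv u" z] by (simp add: comm_def m_assoc)
  qed
  then have "act (comm g u) a = act g a" "act (comm g u) b = act g b"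
    using assms xy' by auto
  then show ?thesis
    using g u comm_in_derived[of g "carrier G" u] by (intro bexI[of _ "comm g u"]) auto
qed

lemma proximal_action_commutator_subgroup: "proximal_action (commutator_subgroup G) \<Omega> act"
proof -
  have D: "subgroup (derived G (carrier G)) G"
    by (simp add: derived_is_subgroup)
  then have sub: "g \<in> carrier G" if "g \<in> derived G (carrier G)" for g
    using that by (rule subgroup.mem_carrier)
  have C: "group (commutator_subgroup G)"
    unfolding commutator_subgroup_def by (rule subgroup_imp_group[OF D])
  show ?thesis
  proof (rule proximal_action.intro[OF C proximal_action_axioms.intro], goal_cases)
    case (1 g x)
    then show ?case using act_closed sub by (simp add: commutator_subgroup_def)
  next
    case (2 g h x)
    then show ?case using act_mult sub by (simp add: commutator_subgroup_def)
  next
    case (3 g)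
    then show ?case using faithful sub by (simp add: commutator_subgroup_def)
  next
    case (4 g x y)
    then show ?case using act_less sub by (simp add: commutator_subgroup_def)
  next
    case (5 g)
    then show ?case using bounded sub by (simp add: commutator_subgroup_def)
  next
    case (6 a b c d)
    then show ?case using derived_proximal by (simp add: commutator_subgroup_def)
  qed
qed

lemma commutator_subgroup_perfect:
  "derived (commutator_subgroup G) (carrier (commutator_subgroup G)) = carrier (commutator_subgroup G)"
  using derived_derived derived_consistent[OF order.refl derived_is_subgroup[of "carrier G"]]
  by (simp add: commutator_subgroup_def)

text \<open>Membership records that the entries of every commutator, and not merely the product, are
  supported in \<open>U\<close>. The one-sided shape of \<open>step\<close> allows an induction that
  removes the first commutator.\<close>

inductive_set comm_prods :: "'x set \<Rightarrow> 'a set" for U where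
  one: "\<one> \<in> comm_prods U"
| step: "a \<in> rist U \<Longrightarrow> b \<in> rist U \<Longrightarrow> f \<in> comm_prods U \<Longrightarrow> comm a b \<otimes> f \<in> comm_prods U"

lemma comm_prods_rist: "f \<in> comm_prods U \<Longrightarrow> f \<in> rist U"
  by (induction rule: comm_prods.induct) (auto intro: rist_one rist_mult rist_comm)

lemma comm_prods_mono:
  assumes "f \<in> comm_prods U" "U \<subseteq> V"
  shows "f \<in> comm_prods V"
  using assms(1)
  by (induction rule: comm_prods.induct) (use rist_mono[OF assms(2)] in \<open>auto intro: comm_prods.intros\<close>)

lemma comm_prods_mult:
  assumes "f \<in> comm_prods U" "g \<in> comm_prods U"
  shows "f \<otimes> g \<in> comm_prods U"
  using assms(1)
proof (induction rule: comm_prods.induct)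
  case one
  show ?case
    using rist_carrier[OF comm_prods_rist[OF assms(2)]] assms(2) by simp
next
  case (step a b f)
  have "comm a b \<otimes> f \<otimes> g = comm a b \<otimes> (f \<otimes> g)"
    using step comm_prods_rist assms(2) rist_carrier by (intro m_assoc) blast+
  then show ?case
    using comm_prods.step[OF step(1,2) step.IH] by simp
qed

lemma comm_prods_conj:
  assumes "f \<in> comm_prods U" "h \<in> carrier G" "\<And>x. x \<in> \<Omega> \<Longrightarrow> x \<in> U \<Longrightarrow> act h x \<in> V"
  shows "h \<otimes> f \<otimes> inv h \<in> comm_prods V"
  using assms(1)
proof (induction rule: comm_prods.induct)
  case one
  then show ?case
    using assms(2) by (simp add: comm_prods.one)
next
  case (step a b f)
  then have "h \<otimes> (comm a b \<otimes> f) \<otimes> inv h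
      = comm (h \<otimes> a \<otimes> inv h) (h \<otimes> b \<otimes> inv h) \<otimes> (h \<otimes> f \<otimes> inv h)"
    using assms(2) rist_carrier[OF comm_prods_rist[OF step(3)]] rist_carrier[OF step(1)]
      rist_carrier[OF step(2)]
    by (subst conj_mult) (auto simp: conj_comm)
  then show ?case
    using step assms(2,3) by (auto intro!: comm_prods.step rist_conj)
qed

text \<open>A product of commutators has finitely many entries, each with bounded support, so one
  interval holds them all. Inverses cause no trouble because the inverse of a commutator is a
  commutator.\<close>

lemma derived_comm_prods:
  assumes "f \<in> derived G (carrier G)"
  shows "\<exists>a\<in>\<Omega>. \<exists>b\<in>\<Omega>. a < b \<and> f \<in> comm_prods {a<..<b}"
proof -
  have c: "\<exists>x\<in>\<Omega>. \<exists>y\<in>\<Omega>. x < y \<and> comm a b \<in> comm_prods {x<..<y}"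
    if ab: "a \<in> carrier G" "b \<in> carrier G" for a b
  proof -
    obtain x y where "x \<in> \<Omega>" "y \<in> \<Omega>" "x < y" "a \<in> rist {x<..<y}" "b \<in> rist {x<..<y}"
      using common_interval[of "{a, b}"] ab by auto
    then show ?thesis
      using comm_prods.step[OF _ _ comm_prods.one, of a _ b] ab by auto
  qed
  from assms have "f \<in> generate G {comm a b | a b. a \<in> carrier G \<and> b \<in> carrier G}"
    unfolding derived_def derived_set_eq_comm .
  then show ?thesis
  proof (induction rule: generate.induct)
    case one
    then show ?case
      using bounded[of \<one>] comm_prods.one by auto
  next
    case (incl h)
    then show ?case using c by auto
  next
    case (inv h)
    then show ?case using c comm_inv by auto
  next
    case (eng f g)
    then obtain a b c d where ab: "a \<in> \<Omega>" "b \<in> \<Omega>" "a < b" "f \<in> comm_prods {a<..<b}"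
      and cd: "c \<in> \<Omega>" "d \<in> \<Omega>" "c < d" "g \<in> comm_prods {c<..<d}"
      by auto
    have "f \<in> comm_prods {min a c<..<max b d}" "g \<in> comm_prods {min a c<..<max b d}"
      by (auto intro!: comm_prods_mono[OF ab(4)] comm_prods_mono[OF cd(4)]
          simp: min_less_iff_disj less_max_iff_disj)
    moreover have "min a c \<in> \<Omega>" "max b d \<in> \<Omega>" "min a c < max b d"
      using ab cd by (auto simp: min_def max_def)
    ultimately show ?case
      using comm_prods_mult by blast
  qed
qed

text \<open>
  Burago and Ivanov's infinite-repetition trick: shift the \<open>i\<close>-th commutator by \<open>t\<^sup>i\<close>, so that
  the factors commute and merge into one commutator; a telescoping product \<open>comm F t\<close> corrects
  the shifts. The induction peels off the first commutator.
\<close>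

lemma two_commutators:
  assumes t: "t \<in> carrier G" and x: "x \<in> \<Omega>" "x < act t x" and f: "f \<in> comm_prods {x<..<act t x}"
  shows "\<exists>A\<in>rist {x<..}. \<exists>B\<in>rist {x<..}. \<exists>F\<in>rist {x<..}. f = comm A B \<otimes> comm F t"
  using f
proof (induction rule: comm_prods.induct)
  case one
  show ?case
    using t by (intro bexI[of _ \<one>]) (auto simp: comm_def rist_one)
next
  case (step a b f)
  define U where "U = {x<..<act t x}"
  define s where "s = (\<lambda>g. t \<otimes> g \<otimes> inv t)"
  note step = step[folded U_def]
  obtain A B F where ABF: "A \<in> rist {x<..}" "B \<in> rist {x<..}" "F \<in> rist {x<..}"
    and f: "f = comm A B \<otimes> comm F t"
    using step.IH by blast
  have UV: "rist U \<subseteq> rist {x<..}" "rist {act t x<..} \<subseteq> rist {x<..}"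
    using x by (auto intro!: rist_mono simp: U_def)
  have s_rist: "s g \<in> rist {act t x<..}" if "g \<in> rist {x<..}" for g
    unfolding s_def using that t x by (intro rist_conj) (auto simp: act_less)
  have s_comm: "s (comm g h) = comm (s g) (s h)" if "g \<in> carrier G" "h \<in> carrier G" for g h
    unfolding s_def using that t by (simp add: conj_comm)
  have s_mult: "s (g \<otimes> h) = s g \<otimes> s h" if "g \<in> carrier G" "h \<in> carrier G" for g h
    unfolding s_def using that t by (simp add: conj_mult)
  have com: "g \<otimes> h = h \<otimes> g" if "g \<in> rist U" "h \<in> rist {act t x<..}" for g h
    using that by (intro rist_commute) (auto simp: U_def)
  have car: "a \<in> carrier G" "b \<in> carrier G" "A \<in> carrier G" "B \<in> carrier G" "F \<in> carrier G" "f \<in> carrier G"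
    using step ABF comm_prods_rist rist_carrier by auto
  have s_car: "s g \<in> carrier G" if "g \<in> carrier G" for g
    using that t by (simp add: s_def)
  have Fs: "comm g t = g \<otimes> inv (s g)" if "g \<in> carrier G" for g
    using that t by (simp add: comm_def s_def inv_mult_group m_assoc)
  define A' where "A' = a \<otimes> s A"
  define B' where "B' = b \<otimes> s B"
  \<comment> \<open>Unfolding the recursion, \<open>F'\<close> is the product of the
    \<open>i\<close>-th translates of the tails of the product, the first tail (\<open>f\<close>
    itself) being untranslated. As \<open>comm F' t\<close> equals
    \<open>F' \<otimes> inv (s F')\<close>, consecutive translates are compared, and this is what
    telescopes.\<close>
  define F' where "F' = f \<otimes> s F"
  have fU: "f \<in> rist U"
    using step(3) by (rule comm_prods_rist)
  have "A' \<in> rist {x<..}" "B' \<in> rist {x<..}" "F' \<in> rist {x<..}"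
    unfolding A'_def B'_def F'_def
    using step(1,2) fU UV s_rist ABF by (blast intro!: rist_mult)+
  moreover have "comm a b \<otimes> f = comm A' B' \<otimes> comm F' t"
  proof -
    have AB: "comm A B = f \<otimes> (s F \<otimes> inv F)"
      using f car s_car by (simp add: Fs m_assoc inv_mult_group)
    have "comm A' B' = comm a b \<otimes> s (comm A B)"
      unfolding A'_def B'_def
      using step(1,2) ABF s_rist car s_car
      by (subst comm_mult_commuting) (auto simp: s_comm intro: com)
    also have "s (comm A B) = s f \<otimes> (s (s F) \<otimes> inv (s F))"
      using car s_car t by (simp add: AB s_mult) (simp add: s_def conj_inv)
    finally have 1: "comm A' B' = comm a b \<otimes> (s f \<otimes> (s (s F) \<otimes> inv (s F)))" .
    \<comment> \<open>\<open>f\<close> lives in \<open>U\<close> and the translates live to the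
      right of \<open>U\<close>. So \<open>f\<close> can be moved to the end, where it survives
      while the translates cancel against those in \<open>comm A' B'\<close>.\<close>
    have "comm F' t = s F \<otimes> f \<otimes> inv (s f \<otimes> s (s F))"
    proof -
      have "comm F' t = (f \<otimes> s F) \<otimes> inv (s f \<otimes> s (s F))"
        unfolding F'_def using car s_car by (simp add: Fs s_mult)
      then show ?thesis
        by (simp only: com[OF fU s_rist[OF ABF(3)]])
    qed
    moreover have "f \<otimes> inv (s f \<otimes> s (s F)) = inv (s f \<otimes> s (s F)) \<otimes> f"
    proof (intro com[OF fU] rist_inv rist_mult)
      show "s f \<in> rist {act t x<..}" using s_rist fU UV by auto
      show "s (s F) \<in> rist {act t x<..}" using s_rist[OF ABF(3)] s_rist UV by auto
    qed
    ultimately have 2: "comm F' t = s F \<otimes> (inv (s f \<otimes> s (s F)) \<otimes> f)"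
      using car s_car by (simp add: m_assoc)
    show ?thesis
      unfolding 1 2 using car s_car by (simp add: m_assoc inv_mult_group)
  qed
  ultimately show ?case
    by blast
qed

end

section \<open>Word norm balls of a set in a group\<close>

context group
begin

lemma list_prod_closed: "set gs \<subseteq> carrier G \<Longrightarrow> list_prod G gs \<in> carrier G"
  by (induction gs) (auto simp: list_prod_def)

lemma list_prod_append:
  "set gs \<subseteq> carrier G \<Longrightarrow> set hs \<subseteq> carrier G \<Longrightarrow>
    list_prod G (gs @ hs) = list_prod G gs \<otimes> list_prod G hs"
proof (induction gs)
  case Nil
  then show ?case using list_prod_closed[of hs] by (simp add: list_prod_def)
next
  case (Cons g gs)
  then show ?case
    using list_prod_closed[of gs] list_prod_closed[of hs] by (simp add: list_prod_def m_assoc)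
qed

lemma list_prod_conj:
  assumes "h \<in> carrier G" "set gs \<subseteq> carrier G"
  shows "h \<otimes> list_prod G gs \<otimes> inv h = list_prod G (map (\<lambda>g. h \<otimes> g \<otimes> inv h) gs)"
  using assms(2)
proof (induction gs)
  case Nil
  then show ?case using assms(1) by (simp add: list_prod_def)
next
  case (Cons g gs)
  then show ?case
    using assms(1) list_prod_closed[of gs] conj_mult[of h g "list_prod G gs"]
    by (simp add: list_prod_def)
qed

text \<open>The ball of radius \<open>n\<close> in the word norm of \<open>D\<close>. When
  \<open>D\<close> is symmetric and invariant under conjugation, so are the balls.\<close>

definition products :: "'a set \<Rightarrow> nat \<Rightarrow> 'a set" where
  "products D n = {list_prod G gs | gs. length gs \<le> n \<and> set gs \<subseteq> D}"

lemma products_single: "d \<in> D \<Longrightarrow> D \<subseteq> carrier G \<Longrightarrow> d \<in> products D (Suc 0)"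
  unfolding products_def by (auto simp: list_prod_def intro!: exI[of _ "[d]"])

lemma products_mult:
  assumes "f \<in> products D m" "g \<in> products D n" "D \<subseteq> carrier G"
  shows "f \<otimes> g \<in> products D (m + n)"
proof -
  obtain fs gs where "length fs \<le> m" "set fs \<subseteq> D" "f = list_prod G fs"
    "length gs \<le> n" "set gs \<subseteq> D" "g = list_prod G gs"
    using assms(1,2) by (auto simp: products_def)
  then show ?thesis
    using list_prod_append[of fs gs] assms(3) by (auto simp: products_def intro!: exI[of _ "fs @ gs"])
qed

lemma products_conj:
  assumes "f \<in> products D n" "D \<subseteq> carrier G" "h \<in> carrier G" "\<And>d. d \<in> D \<Longrightarrow> h \<otimes> d \<otimes> inv h \<in> D"
  shows "h \<otimes> f \<otimes> inv h \<in> products D n"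
proof -
  obtain fs where "length fs \<le> n" "set fs \<subseteq> D" "f = list_prod G fs"
    using assms(1) by (auto simp: products_def)
  then show ?thesis
    using list_prod_conj[OF assms(3), of fs] assms(2,4)
    by (auto simp: products_def subset_iff intro!: exI[of _ "map (\<lambda>g. h \<otimes> g \<otimes> inv h) fs"])
qed

lemma products_inv:
  assumes "f \<in> products D n" "D \<subseteq> carrier G" "\<And>d. d \<in> D \<Longrightarrow> inv d \<in> D"
  shows "inv f \<in> products D n"
proof -
  have *: "inv (list_prod G fs) = list_prod G (rev (map (m_inv G) fs))" if "set fs \<subseteq> D" for fs
    using that
  proof (induction fs)
    case Nil
    then show ?case by (simp add: list_prod_def)
  next
    case (Cons d fs)
    then have d: "d \<in> carrier G" and fs: "m_inv G ` set fs \<subseteq> carrier G"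
      using assms(2) by auto
    have "list_prod G (rev (map (m_inv G) (d # fs)))
        = list_prod G (rev (map (m_inv G) fs)) \<otimes> list_prod G [inv d]"
      using d fs list_prod_append[of "rev (map (m_inv G) fs)" "[inv d]"] by simp
    then have "list_prod G (rev (map (m_inv G) (d # fs))) = list_prod G (rev (map (m_inv G) fs)) \<otimes> inv d"
      using d by (simp add: list_prod_def)
    moreover have "inv (list_prod G (d # fs)) = inv (list_prod G fs) \<otimes> inv d"
      using Cons.prems assms(2) list_prod_closed[of fs] inv_mult_group[of d "list_prod G fs"]
      by (auto simp: list_prod_def)
    ultimately show ?case
      using Cons by simp
  qed
  obtain fs where "length fs \<le> n" "set fs \<subseteq> D" "f = list_prod G fs"
    using assms(1) by (auto simp: products_def)
  then show ?thesis
    using *[of fs] assms(3) by (auto simp: products_def subset_iff intro!: exI[of _ "rev (map (m_inv G) fs)"])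
qed

text \<open>A commutator is an element times a conjugate of its inverse, so the radius doubles.
  Starting from a single element of \<open>D\<close> this gives 2, and applied once more it gives
  4.\<close>

lemma products_comm:
  assumes "f \<in> products D n" "D \<subseteq> carrier G" "h \<in> carrier G"
    and "\<And>d. d \<in> D \<Longrightarrow> inv d \<in> D" "\<And>d. d \<in> D \<Longrightarrow> h \<otimes> d \<otimes> inv h \<in> D"
  shows "comm f h \<in> products D (n + n)" "comm h f \<in> products D (n + n)"
proof -
  have "f \<in> carrier G"
    using assms(1,2) list_prod_closed by (auto simp: products_def)
  then have "comm f h = f \<otimes> (h \<otimes> inv f \<otimes> inv h)" "comm h f = (h \<otimes> f \<otimes> inv h) \<otimes> inv f"
    using assms(3) by (simp_all add: comm_def m_assoc)
  then show "comm f h \<in> products D (n + n)" "comm h f \<in> products D (n + n)"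
    using assms by (simp_all add: products_mult products_conj products_inv)
qed

end

context proximal_action
begin

text \<open>
  Writing \<open>f\<close> as \<open>comm A B \<otimes> comm F t\<close>, the second commutator needs two conjugates
  of \<open>t\<close> and its inverse, and the first needs four, since it equals \<open>comm (comm A t) B\<close> as soon as
  \<open>t\<close> displaces the supports of \<open>A\<close> and \<open>B\<close>.
\<close>

lemma perfect_six_products:
  assumes perfect: "derived G (carrier G) = carrier G"
    and D: "D \<subseteq> carrier G" "\<And>d. d \<in> D \<Longrightarrow> inv d \<in> D"
      "\<And>h d. h \<in> carrier G \<Longrightarrow> d \<in> D \<Longrightarrow> h \<otimes> d \<otimes> inv h \<in> D"
    and t: "t \<in> D" "t \<noteq> \<one>" and f: "f \<in> carrier G"
  shows "f \<in> products D 6"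
proof -
  obtain z where z: "z \<in> \<Omega>" "act t z \<noteq> z"
    using faithful t D(1) by blast
  \<comment> \<open>If \<open>t\<close> moves \<open>z\<close> down, its inverse moves
    \<open>z\<close> up, and \<open>D\<close> is symmetric.\<close>
  have "\<exists>t\<in>D. z < act t z"
  proof (cases "z < act t z")
    case False
    then have "act t z < z"
      using z by simp
    then have "z < act (inv t) z"
      using act_less[of "inv t" "act t z" z] act_inv(1)[of t z] act_closed z t D(1) by auto
    then show ?thesis
      using D(2) t by blast
  qed (use t in blast)
  then obtain t where t: "t \<in> D" "z < act t z"
    by blast
  have tc: "t \<in> carrier G" "act t z \<in> \<Omega>"
    using t D(1) z act_closed by auto
  define J where "J = {z<..<act t z}"
  have into_J: "\<exists>h\<in>carrier G. \<forall>x\<in>\<Omega>. a < x \<and> x < b \<longrightarrow> act h x \<in> J"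
    if ab: "a \<in> \<Omega>" "b \<in> \<Omega>" "a < b" for a b
  proof -
    obtain h where h: "h \<in> carrier G" "z < act h a" "act h b < act t z"
      using proximal[OF ab(1,2) z(1) tc(2) ab(3) t(2)] by blast
    have "act h x \<in> J" if "x \<in> \<Omega>" "a < x" "x < b" for x
      using act_less[OF h(1) ab(1) that(1,2)] act_less[OF h(1) that(1) ab(2) that(3)] h(2,3)
      unfolding J_def by (auto intro: less_trans)
    then show ?thesis
      using h(1) by blast
  qed
  obtain a b where ab: "a \<in> \<Omega>" "b \<in> \<Omega>" "a < b" "f \<in> comm_prods {a<..<b}"
    using derived_comm_prods f perfect by blast
  obtain h where h: "h \<in> carrier G" "\<And>x. x \<in> \<Omega> \<Longrightarrow> a < x \<Longrightarrow> x < b \<Longrightarrow> act h x \<in> J"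
    using into_J[OF ab(1-3)] by blast
  have hfJ: "h \<otimes> f \<otimes> inv h \<in> comm_prods {z<..<act t z}"
    unfolding J_def[symmetric]
    using h by (intro comm_prods_conj[OF ab(4)]) auto
  obtain A B F where "A \<in> rist {z<..}" "B \<in> rist {z<..}" "F \<in> rist {z<..}"
    and hf: "h \<otimes> f \<otimes> inv h = comm A B \<otimes> comm F t"
    using two_commutators[OF tc(1) z(1) t(2) hfJ] by blast
  then have ABF: "A \<in> carrier G" "B \<in> carrier G" "F \<in> carrier G"
    by (auto dest: rist_carrier)
  \<comment> \<open>The supports of \<open>A\<close> and \<open>B\<close> may spread over many
    translates of \<open>J\<close>. A second conjugation compresses them into \<open>J\<close>,
    where \<open>t\<close> displaces both at once.\<close>
  obtain c d where cd: "c \<in> \<Omega>" "d \<in> \<Omega>" "c < d" "A \<in> rist {c<..<d}" "B \<in> rist {c<..<d}"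
    using common_interval[of "{A, B}"] ABF by auto
  obtain k where k: "k \<in> carrier G" "\<And>x. x \<in> \<Omega> \<Longrightarrow> c < x \<Longrightarrow> x < d \<Longrightarrow> act k x \<in> J"
    using into_J[OF cd(1-3)] by blast
  define A' where "A' = k \<otimes> A \<otimes> inv k"
  define B' where "B' = k \<otimes> B \<otimes> inv k"
  have AB': "A' \<in> rist J" "B' \<in> rist J"
    unfolding A'_def B'_def using k by (auto intro!: rist_conj[OF cd(4)] rist_conj[OF cd(5)])
  then have car: "A' \<in> carrier G" "B' \<in> carrier G"
    by (auto dest: rist_carrier)
  define A'' where "A'' = t \<otimes> inv A' \<otimes> inv t"
  \<comment> \<open>Being supported beyond \<open>J\<close>, the second factor of
    \<open>comm A' t\<close> commutes with \<open>A'\<close> and \<open>B'\<close> and so drops out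
    of the commutator with \<open>B'\<close>.\<close>
  have A''_rist: "A'' \<in> rist {act t z<..}"
    unfolding A''_def using tc z by (intro rist_conj[OF rist_inv[OF AB'(1)]]) (auto simp: J_def act_less)
  have com: "A' \<otimes> A'' = A'' \<otimes> A'" "B' \<otimes> A'' = A'' \<otimes> B'"
    by (rule rist_commute[OF AB'(1) A''_rist] rist_commute[OF AB'(2) A''_rist]; auto simp: J_def)+
  have A'': "A'' \<in> carrier G"
    using A''_rist by (rule rist_carrier)
  have "comm A' t = A' \<otimes> A''"
    using car tc by (simp add: comm_def A''_def m_assoc)
  then have "comm (comm A' t) B' = comm (A' \<otimes> A'') (B' \<otimes> \<one>)"
    using car by simp
  also have "\<dots> = comm A' B' \<otimes> comm A'' \<one>"
    using car A'' com by (intro comm_mult_commuting) auto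
  also have "comm A'' \<one> = \<one>"
    using A'' by (intro comm_eq_one) auto
  finally have "comm A' B' = comm (comm A' t) B'"
    using car by simp
  moreover have 1: "comm x t \<in> products D 2" if "x \<in> carrier G" for x
    using products_comm(2)[OF products_single[OF t(1) D(1)] D(1) that D(2) D(3)] that
    by (simp add: numeral_2_eq_2)
  moreover have "comm (comm A' t) B' \<in> products D 4"
    using products_comm(1)[OF 1[OF car(1)] D(1) car(2) D(2) D(3)] car by simp
  ultimately have "k \<otimes> comm A B \<otimes> inv k \<in> products D 4"
    using conj_comm[of k A B] k ABF by (simp add: A'_def B'_def)
  then have "inv k \<otimes> (k \<otimes> comm A B \<otimes> inv k) \<otimes> inv (inv k) \<in> products D 4"
    by (rule products_conj[OF _ D(1) inv_closed[OF k(1)] D(3)[OF inv_closed[OF k(1)]]])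
  then have "comm A B \<in> products D 4"
    using k ABF by (simp add: m_assoc)
  then have "h \<otimes> f \<otimes> inv h \<in> products D 6"
    unfolding hf using products_mult[OF _ 1[OF ABF(3)] D(1), of "comm A B" 4] by simp
  then have "inv h \<otimes> (h \<otimes> f \<otimes> inv h) \<otimes> inv (inv h) \<in> products D 6"
    by (rule products_conj[OF _ D(1) inv_closed[OF h(1)] D(3)[OF inv_closed[OF h(1)]]])
  then show ?thesis
    using h f by (simp add: m_assoc)
qed

lemma perfect_uniformly_simple:
  assumes perfect: "derived G (carrier G) = carrier G"
  shows "uniformly_simple 6 G"
  unfolding uniformly_simple_def
proof (intro conjI ballI)
  show "group G" ..
  fix f C
  assume f: "f \<in> carrier G - {\<one>}" and C: "C \<in> conjugacy_class G ` carrier G - {{\<one>}}"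
  obtain g where g: "g \<in> carrier G" "C = conjugacy_class G g"
    using C by blast
  have "conjugacy_class G \<one> = {\<one>}"
    unfolding conjugacy_class_def by force
  then have "g \<noteq> \<one>"
    using C g(2) by blast
  have "g \<in> C"
    unfolding g(2) conjugacy_class_def using g(1) by (auto intro!: exI[of _ \<one>])
  define D where "D = C \<union> m_inv G ` C"
  have sub: "D \<subseteq> carrier G"
    using g by (auto simp: D_def conjugacy_class_def)
  have conjC: "h \<otimes> c \<otimes> inv h \<in> C" if "h \<in> carrier G" "c \<in> C" for h c
  proof -
    obtain k where k: "k \<in> carrier G" "c = k \<otimes> g \<otimes> inv k"
      using \<open>c \<in> C\<close> g by (auto simp: conjugacy_class_def)
    then have "h \<otimes> c \<otimes> inv h = (h \<otimes> k) \<otimes> g \<otimes> inv (h \<otimes> k)"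
      using conj_conj[OF \<open>h \<in> carrier G\<close> k(1) g(1)] by simp
    then show ?thesis
      using \<open>h \<in> carrier G\<close> k(1) g by (auto simp: conjugacy_class_def)
  qed
  have "inv d \<in> D" if "d \<in> D" for d
    using that sub by (auto simp: D_def)
  moreover have "h \<otimes> d \<otimes> inv h \<in> D" if h: "h \<in> carrier G" and d: "d \<in> D" for h d
  proof (cases "d \<in> C")
    case False
    then obtain c where "c \<in> C" "d = inv c"
      using d by (auto simp: D_def)
    then show ?thesis
      using conjC[OF h] conj_inv[OF h, of c] sub by (auto simp: D_def)
  qed (use conjC h in \<open>auto simp: D_def\<close>)
  ultimately have "f \<in> products D 6"
    using f sub \<open>g \<in> C\<close> \<open>g \<noteq> \<one>\<close> by (intro perfect_six_products[OF perfect, of D g]) (auto simp: D_def)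
  then show "\<exists>gs. length gs \<le> 6 \<and> set gs \<subseteq> C \<union> m_inv G ` C \<and> f = list_prod G gs"
    by (auto simp: products_def D_def)
qed

text \<open>Here \<open>t\<close> may be chosen freely. With \<open>t\<close> taking
  \<open>a\<close> beyond \<open>b\<close>, the support interval lies between \<open>a\<close> and
  \<open>act t a\<close>, and the two commutators arise without any prior conjugation.\<close>

lemma perfect_commutator_width:
  assumes perfect: "derived G (carrier G) = carrier G"
  shows "commutator_width G \<le> 2"
  unfolding commutator_width_def
proof (rule SUP_least)
  fix f
  assume f: "f \<in> derived G (carrier G)"
  obtain a b where ab: "a \<in> \<Omega>" "b \<in> \<Omega>" "a < b" "f \<in> comm_prods {a<..<b}"
    using derived_comm_prods f by blast
  obtain t where t: "t \<in> carrier G" "b < act t a"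
    using displace ab by blast
  have ft: "f \<in> comm_prods {a<..<act t a}"
    by (rule comm_prods_mono[OF ab(4)]) (use t in auto)
  have at: "a < act t a"
    using t(2) ab(3) by simp
  obtain A B F where "A \<in> rist {a<..}" "B \<in> rist {a<..}" "F \<in> rist {a<..}"
    and f: "f = comm A B \<otimes> comm F t"
    using two_commutators[OF t(1) ab(1) at ft] by blast
  then have ABF: "A \<in> carrier G" "B \<in> carrier G" "F \<in> carrier G"
    by (auto dest: rist_carrier)
  have "set [comm A B, comm F t] \<subseteq> derived_set G (carrier G)
      \<and> list_prod G [comm A B, comm F t] = f"
    unfolding derived_set_eq_comm f using ABF t(1) by (auto simp: list_prod_def)
  then have "commutator_length G f \<le> enat (length [comm A B, comm F t])"
    unfolding commutator_length_def by (intro INF_lower) blast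
  moreover have "enat (length [comm A B, comm F t]) = 2"
    by (simp add: numeral_eq_enat)
  ultimately show "commutator_length G f \<le> 2"
    by (simp only:)
qed

theorem commutator_subgroup_uniformly_simple: "uniformly_simple 6 (commutator_subgroup G)"
  and commutator_width_commutator_subgroup: "commutator_width (commutator_subgroup G) \<le> 2"
  using proximal_action.perfect_uniformly_simple[OF proximal_action_commutator_subgroup]
    proximal_action.perfect_commutator_width[OF proximal_action_commutator_subgroup]
    commutator_subgroup_perfect by blast+

end

text \<open>This lets the boundedly supported group of the interval act on the line, so that
  proximality is verified there alone.\<close>

lemma proximal_action_pullback:
  assumes "proximal_action H \<Omega> act" "group G" "h \<in> iso G H"
  shows "proximal_action G \<Omega> (\<lambda>g. act (h g))"
proof -
  interpret H: proximal_action H \<Omega> act by fact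
  interpret G: group G by fact
  have bij: "bij_betw h (carrier G) (carrier H)" and hom: "h \<in> hom G H"
    using assms(3) by (auto simp: iso_def)
  interpret group_hom G H h
    by unfold_locales (fact hom)
  show ?thesis
  proof (rule proximal_action.intro[OF assms(2) proximal_action_axioms.intro], goal_cases)
    case (1 g x)
    then show ?case by (simp add: H.act_closed)
  next
    case (2 g g' x)
    then show ?case by (simp add: H.act_mult)
  next
    case (3 g)
    then have "h g = h \<one>\<^bsub>G\<^esub>"
      using H.faithful[of "h g"] by simp
    then show ?case
      using inj_onD[OF bij_betw_imp_inj_on[OF bij]] 3(1) by blast
  next
    case (4 g x y)
    then show ?case by (simp add: H.act_less)
  next
    case (5 g)
    then show ?case by (simp add: H.bounded)
  next
    case (6 a b c d)
    then obtain g where "g \<in> carrier H" "c < act g a" "act g b < d"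
      using H.proximal by blast
    moreover obtain g' where "g' \<in> carrier G" "g = h g'"
      using bij \<open>g \<in> carrier H\<close> by (auto simp: bij_betw_def)
    ultimately show ?case by blast
  qed
qed

section \<open>Piecewise affine isomorphisms\<close>

locale base =
  fixes q :: nat
  assumes q: "1 < q"
begin

abbreviation Zq :: "real set" where
  "Zq \<equiv> Z_inverse q"

section \<open>Arithmetic and density of Z[1/q]\<close>

lemma q_real: "1 < real q" "0 < real q" "real q \<noteq> 0"
  using q by auto

lemma Zq_of_int [simp]: "of_int a \<in> Zq"
  unfolding Z_inverse_def by (rule CollectI, rule exI[of _ a], rule exI[of _ 0]) simp

lemma Zq_consts [simp]: "0 \<in> Zq" "1 \<in> Zq" "real n \<in> Zq"
  using Zq_of_int[of 0] Zq_of_int[of 1] Zq_of_int[of "int n"] by simp_all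

lemma Zq_add [intro]:
  assumes "x \<in> Zq" "y \<in> Zq"
  shows "x + y \<in> Zq"
proof -
  obtain a b :: int and m n where "x = a / real q ^ m" "y = b / real q ^ n"
    using assms by (auto simp: Z_inverse_def)
  then have "x + y = of_int (a * int q ^ n + b * int q ^ m) / real q ^ (m + n)"
    using q_real by (simp add: power_add add_frac_eq)
  then show ?thesis
    unfolding Z_inverse_def by blast
qed

lemma Zq_mult [intro]:
  assumes "x \<in> Zq" "y \<in> Zq"
  shows "x * y \<in> Zq"
proof -
  obtain a b :: int and m n where "x = a / real q ^ m" "y = b / real q ^ n"
    using assms by (auto simp: Z_inverse_def)
  then have "x * y = of_int (a * b) / real q ^ (m + n)"
    by (simp add: power_add)
  then show ?thesis
    unfolding Z_inverse_def by blast
qed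

lemma Zq_minus [intro]: "x \<in> Zq \<Longrightarrow> - x \<in> Zq"
  using Zq_mult[of "- 1" x] Zq_of_int[of "- 1"] by simp

lemma Zq_diff [intro]: "x \<in> Zq \<Longrightarrow> y \<in> Zq \<Longrightarrow> x - y \<in> Zq"
  using Zq_add[of x "- y"] Zq_minus by simp

lemma Zq_inverse_power [simp]: "1 / real q ^ n \<in> Zq"
  unfolding Z_inverse_def by (rule CollectI, rule exI[of _ 1], rule exI[of _ n]) simp

lemma Zq_divide_power [intro]: "x \<in> Zq \<Longrightarrow> x / real q ^ n \<in> Zq"
  using Zq_mult[of x "1 / real q ^ n"] by simp

lemma Zq_divide [intro]: "x \<in> Zq \<Longrightarrow> x / real q \<in> Zq"
  using Zq_divide_power[of x 1] by simp

lemma Zq_powi [simp]: "real q powi k \<in> Zq"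
proof (cases "0 \<le> k")
  case True
  then show ?thesis
    using Zq_of_int[of "int q ^ nat k"] by (simp add: power_int_def)
next
  case False
  then show ?thesis
    using Zq_inverse_power[of "nat (- k)"] by (simp add: power_int_def power_one_over inverse_eq_divide)
qed

lemma small_inverse_power: "0 < e \<Longrightarrow> \<exists>n. 1 / real q ^ n < e"
  using real_arch_pow_inv[of e "1 / real q"] q_real by (auto simp: power_one_over)

lemma Zq_dense:
  assumes "x < y"
  shows "\<exists>z\<in>Zq. x < z \<and> z < y"
proof -
  obtain n where n: "1 / real q ^ n < y - x"
    using small_inverse_power[of "y - x"] assms by auto
  define z where "z = of_int (\<lfloor>x * real q ^ n\<rfloor> + 1) / real q ^ n"
  have "0 < real q ^ n"
    using q_real by simp
  then have "x < z"
    unfolding z_def by (simp add: less_divide_eq)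
  moreover have "z \<le> x + 1 / real q ^ n"
    unfolding z_def using q_real by (simp add: divide_le_eq distrib_right)
  moreover have "z \<in> Zq"
    unfolding z_def by (simp add: Zq_divide_power del: of_int_add)
  ultimately show ?thesis
    using n by (intro bexI[of _ z]) auto
qed

text \<open>A piece is encoded as a set having each breaking point strictly on one side of it,
  rather than as a real interval. Such sets can be transported by a monotone map that is known only
  on a subset of Z[1/q].\<close>

definition sep :: "real set \<Rightarrow> real set \<Rightarrow> bool" where
  "sep B A \<longleftrightarrow> (\<forall>b\<in>B. (\<forall>x\<in>A. x < b) \<or> (\<forall>x\<in>A. b < x))"

definition affine_map :: "real set \<Rightarrow> (real \<Rightarrow> real) \<Rightarrow> bool" where
  "affine_map A f \<longleftrightarrow> (\<exists>(k::int) c. \<forall>x\<in>A. f x = real q powi k * x + c)"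

definition pl :: "real set \<Rightarrow> (real \<Rightarrow> real) \<Rightarrow> bool" where
  "pl A f \<longleftrightarrow> (\<exists>B. finite B \<and> B \<subseteq> Zq \<and> (\<forall>Y\<subseteq>A. sep B Y \<longrightarrow> affine_map Y f))"

text \<open>Convexity ensures that a breaking point in \<open>Zq\<close> outside \<open>A\<close>
  lies strictly to one side of all of \<open>A\<close>, so that it cuts nothing.\<close>

definition zconvex :: "real set \<Rightarrow> bool" where
  "zconvex A \<longleftrightarrow> A \<subseteq> Zq \<and> (\<forall>x\<in>A. \<forall>y\<in>A. \<forall>z\<in>Zq. x \<le> z \<longrightarrow> z \<le> y \<longrightarrow> z \<in> A)"

definition pl_iso :: "real set \<Rightarrow> real set \<Rightarrow> (real \<Rightarrow> real) \<Rightarrow> bool" where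
  "pl_iso A A' f \<longleftrightarrow> strict_mono_on A f \<and> f ` A = A' \<and> pl A f"

lemma piecewise_affine_iff_pl: "piecewise_affine q S f \<longleftrightarrow> pl S f"
proof
  assume "piecewise_affine q S f"
  then obtain B where B: "finite B" "B \<subseteq> Zq" and aff: "\<forall>I. is_interval I \<and> I \<inter> B = {} \<longrightarrow>
      (\<exists>(k::int) (c::real). \<forall>x \<in> S \<inter> I. f x = of_nat q powi k * x + c)"
    unfolding piecewise_affine_def by (elim exE conjE)
  have "affine_map Y f" if Y: "Y \<subseteq> S" "sep B Y" for Y
  proof -
    \<comment> \<open>The convex hull of \<open>Y\<close>. It avoids \<open>B\<close>, since each
      point of \<open>B\<close> is strictly on one side of \<open>Y\<close>.\<close>
    define I where "I = {z. \<exists>x\<in>Y. \<exists>y\<in>Y. x \<le> z \<and> z \<le> y}"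
    have "is_interval I"
      unfolding I_def is_interval_1 by (blast intro: order.trans)
    moreover have "I \<inter> B = {}"
      using Y(2) unfolding I_def sep_def by force
    moreover have YI: "Y \<subseteq> S \<inter> I"
      using Y(1) by (auto simp: I_def)
    ultimately obtain k :: int and c where "\<forall>x \<in> S \<inter> I. f x = of_nat q powi k * x + c"
      using aff by (elim allE[of _ I]) auto
    then show ?thesis
      unfolding affine_map_def using YI by blast
  qed
  then show "pl S f"
    unfolding pl_def using B by blast
next
  assume "pl S f"
  then obtain B where B: "finite B" "B \<subseteq> Zq" and aff: "\<And>Y. Y \<subseteq> S \<Longrightarrow> sep B Y \<Longrightarrow> affine_map Y f"
    unfolding pl_def by blast
  have "affine_map (S \<inter> I) f" if I: "is_interval I" "I \<inter> B = {}" for I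
  proof (rule aff)
    have "b \<in> I" if "x \<in> I" "y \<in> I" "\<not> x < b" "\<not> b < y" for b x y
      using that I(1) unfolding is_interval_1 by (meson not_less)
    then show "sep B (S \<inter> I)"
      using I(2) unfolding sep_def by blast
  qed simp
  then show "piecewise_affine q S f"
    unfolding piecewise_affine_def affine_map_def using B by (intro exI[of _ B]) simp
qed

lemma sep_mono: "sep B V \<Longrightarrow> C \<subseteq> B \<Longrightarrow> W \<subseteq> V \<Longrightarrow> sep C W"
  unfolding sep_def by (meson subsetD)

lemma pl_subset: "pl A f \<Longrightarrow> A' \<subseteq> A \<Longrightarrow> pl A' f"
  unfolding pl_def by (meson order.trans)

lemma affine_map_subset: "affine_map A f \<Longrightarrow> Y \<subseteq> A \<Longrightarrow> affine_map Y f"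
  unfolding affine_map_def by blast

lemma pl_affine: "affine_map A f \<Longrightarrow> pl A f"
  unfolding pl_def using affine_map_subset by blast

lemma affine_map_cong: "affine_map A f \<Longrightarrow> (\<And>x. x \<in> A \<Longrightarrow> f x = g x) \<Longrightarrow> affine_map A g"
  unfolding affine_map_def by metis

lemma affine_map_comp:
  assumes "affine_map A f" "affine_map (f ` A) g"
  shows "affine_map A (\<lambda>x. g (f x))"
proof -
  obtain k c where f: "\<And>x. x \<in> A \<Longrightarrow> f x = real q powi k * x + c"
    using assms(1) unfolding affine_map_def by blast
  obtain l d where g: "\<And>x. x \<in> A \<Longrightarrow> g (f x) = real q powi l * f x + d"
    using assms(2) unfolding affine_map_def by blast
  have "g (f x) = real q powi (l + k) * x + (real q powi l * c + d)" if "x \<in> A" for x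
    using f[OF that] g[OF that] q_real by (simp add: power_int_add algebra_simps)
  then show ?thesis
    unfolding affine_map_def by blast
qed

lemma affine_map_inv:
  assumes "affine_map (g ` A) f" "\<And>y. y \<in> A \<Longrightarrow> f (g y) = y"
  shows "affine_map A g"
proof -
  obtain k c where fk: "\<forall>x\<in>g ` A. f x = real q powi k * x + c"
    using assms(1) unfolding affine_map_def by blast
  have f: "y = real q powi k * g y + c" if "y \<in> A" for y
    using bspec[OF fk imageI[OF that]] assms(2)[OF that] by simp
  have "g y = real q powi (- k) * y + (- (real q powi (- k) * c))" if "y \<in> A" for y
  proof -
    have "real q powi (- k) * y = real q powi (- k) * (real q powi k * g y) + real q powi (- k) * c"
      using f[OF that] by (metis distrib_left)
    then show ?thesis
      using q_real by (simp add: power_int_minus)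
  qed
  then show ?thesis
    unfolding affine_map_def by blast
qed

lemma affine_map_reflect:
  assumes "affine_map A f"
  shows "affine_map (uminus ` A) (\<lambda>x. - f (- x))"
proof -
  obtain k c where "\<And>x. x \<in> A \<Longrightarrow> f x = real q powi k * x + c"
    using assms unfolding affine_map_def by blast
  then have "- f (- x) = real q powi k * x + (- c)" if "x \<in> uminus ` A" for x
    using that by auto
  then show ?thesis
    unfolding affine_map_def by blast
qed

lemma affine_map_translate: "affine_map A (\<lambda>x. x + c)"
  unfolding affine_map_def by (rule exI[of _ 0]) auto

lemma pl_cong:
  assumes "pl A f" "\<And>x. x \<in> A \<Longrightarrow> f x = g x"
  shows "pl A g"
  using assms affine_map_cong unfolding pl_def by (meson subsetD)

lemma pl_isoD:
  assumes "pl_iso A A' f"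
  shows "strict_mono_on A f" "f ` A = A'" "pl A f" "inj_on f A" "bij_betw f A A'"
    "\<And>x. x \<in> A \<Longrightarrow> f x \<in> A'"
    "\<And>x y. x \<in> A \<Longrightarrow> y \<in> A \<Longrightarrow> f x < f y \<longleftrightarrow> x < y"
    "\<And>x y. x \<in> A \<Longrightarrow> y \<in> A \<Longrightarrow> f x \<le> f y \<longleftrightarrow> x \<le> y"
proof -
  show m: "strict_mono_on A f" and "f ` A = A'" "pl A f"
    using assms by (auto simp: pl_iso_def)
  show "inj_on f A" "bij_betw f A A'" "\<And>x. x \<in> A \<Longrightarrow> f x \<in> A'"
    using \<open>f ` A = A'\<close> strict_mono_on_imp_inj_on[OF m] by (auto simp: bij_betw_def)
  show "\<And>x y. x \<in> A \<Longrightarrow> y \<in> A \<Longrightarrow> f x < f y \<longleftrightarrow> x < y"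
    "\<And>x y. x \<in> A \<Longrightarrow> y \<in> A \<Longrightarrow> f x \<le> f y \<longleftrightarrow> x \<le> y"
    by (rule strict_mono_on_less[OF m] strict_mono_on_less_eq[OF m]; assumption)+
qed

lemma pl_iso_cong:
  assumes "pl_iso A A' f" "\<And>x. x \<in> A \<Longrightarrow> f x = g x"
  shows "pl_iso A A' g"
proof -
  have "g ` A = f ` A"
    using assms(2) by (intro image_cong) auto
  moreover have "strict_mono_on A g"
    using pl_isoD(1)[OF assms(1)] assms(2) by (simp add: strict_mono_on_def)
  ultimately show ?thesis
    using assms pl_cong by (auto simp: pl_iso_def)
qed

lemma pl_iso_id: "pl_iso A A (\<lambda>x. x)"
  unfolding pl_iso_def using pl_affine[OF affine_map_translate[of A 0]] by (auto simp: strict_mono_on_def)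

text \<open>By monotonicity a breaking point inside \<open>A'\<close> separates the image exactly as
  its preimage separates \<open>Y\<close>; one outside \<open>A'\<close> has all of
  \<open>A'\<close> on one side. This supplies the breaking points of a composition.\<close>

lemma sep_preimage:
  assumes f: "pl_iso A A' f" and A': "zconvex A'" and B: "B \<subseteq> Zq" and Y: "Y \<subseteq> A"
    and sep: "sep {a \<in> A. f a \<in> B} Y"
  shows "sep B (f ` Y)"
  unfolding sep_def
proof
  fix b assume b: "b \<in> B"
  show "(\<forall>y\<in>f ` Y. y < b) \<or> (\<forall>y\<in>f ` Y. b < y)"
  proof (cases "b \<in> A'")
    case True
    then obtain a where a: "a \<in> A" "f a = b"
      using pl_isoD(2)[OF f] by blast
    then have "(\<forall>x\<in>Y. x < a) \<or> (\<forall>x\<in>Y. a < x)"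
      using sep b unfolding sep_def by blast
    then show ?thesis
      using a Y pl_isoD(7)[OF f] by blast
  next
    case False
    have "\<not> (x \<le> b \<and> b \<le> y)" if "x \<in> A'" "y \<in> A'" for x y
      using that A' False b B unfolding zconvex_def by blast
    moreover have "f ` Y \<subseteq> A'"
      using Y pl_isoD(6)[OF f] by blast
    ultimately show ?thesis
      by (meson not_less order.strict_implies_order subsetD)
  qed
qed

section \<open>Composition, inversion, restriction and gluing\<close>

lemma pl_iso_comp:
  assumes f: "pl_iso A A' f" and g: "pl_iso A' A'' g" and A: "A \<subseteq> Zq" and A': "zconvex A'"
  shows "pl_iso A A'' (\<lambda>x. g (f x))"
proof -
  obtain B where B: "finite B" "B \<subseteq> Zq" "\<And>Y. Y \<subseteq> A \<Longrightarrow> sep B Y \<Longrightarrow> affine_map Y f"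
    using pl_isoD(3)[OF f] unfolding pl_def by blast
  obtain C where C: "finite C" "C \<subseteq> Zq" "\<And>Y. Y \<subseteq> A' \<Longrightarrow> sep C Y \<Longrightarrow> affine_map Y g"
    using pl_isoD(3)[OF g] unfolding pl_def by blast
  define D where "D = B \<union> {a \<in> A. f a \<in> C}"
  have "finite {a \<in> A. f a \<in> C}"
    using finite_vimage_IntI[OF C(1) pl_isoD(4)[OF f]] by (simp add: vimage_def Int_def conj_commute)
  then have "finite D" "D \<subseteq> Zq"
    using A B by (auto simp: D_def)
  moreover have "affine_map Y (\<lambda>x. g (f x))" if Y: "Y \<subseteq> A" "sep D Y" for Y
  proof (rule affine_map_comp[of Y f g])
    show "affine_map Y f"
      using Y by (intro B(3) sep_mono[OF Y(2)]) (auto simp: D_def)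
    have "sep C (f ` Y)"
      using Y by (intro sep_preimage[OF f A' C(2) Y(1)] sep_mono[OF Y(2)]) (auto simp: D_def)
    moreover have "f ` Y \<subseteq> A'"
      using Y pl_isoD(6)[OF f] by blast
    ultimately show "affine_map (f ` Y) g"
      by (intro C(3))
  qed
  ultimately have "pl A (\<lambda>x. g (f x))"
    unfolding pl_def by blast
  moreover have "(\<lambda>x. g (f x)) ` A = A''"
    using pl_isoD(2)[OF f] pl_isoD(2)[OF g] by auto
  moreover have "strict_mono_on A (\<lambda>x. g (f x))"
    using pl_isoD(6,7)[OF f] pl_isoD(7)[OF g] by (auto simp: strict_mono_on_def)
  ultimately show ?thesis
    by (simp add: pl_iso_def)
qed

lemma pl_iso_inv:
  assumes f: "pl_iso A A' f" and A: "zconvex A" and A': "A' \<subseteq> Zq"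
    and g: "\<And>y. y \<in> A' \<Longrightarrow> g y \<in> A \<and> f (g y) = y"
  shows "pl_iso A' A g"
proof -
  obtain B where B: "finite B" "B \<subseteq> Zq" "\<And>Y. Y \<subseteq> A \<Longrightarrow> sep B Y \<Longrightarrow> affine_map Y f"
    using pl_isoD(3)[OF f] unfolding pl_def by blast
  \<comment> \<open>The inverse breaks at the images of the breaking points in \<open>A\<close>;
    those outside \<open>A\<close> are harmless by convexity.\<close>
  define C where "C = f ` (B \<inter> A)"
  have C: "finite C" "C \<subseteq> Zq"
    using B A' pl_isoD(6)[OF f] by (auto simp: C_def)
  have gf: "g (f x) = x" if "x \<in> A" for x
    using g[of "f x"] that pl_isoD(4,6)[OF f] by (auto dest: inj_onD)
  have "affine_map Y g" if Y: "Y \<subseteq> A'" "sep C Y" for Y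
  proof (rule affine_map_inv[of g Y f])
    show "f (g y) = y" if "y \<in> Y" for y
      using that g Y by blast
    show "affine_map (g ` Y) f"
    proof (rule B(3))
      show gY: "g ` Y \<subseteq> A"
        using g Y by blast
      show "sep B (g ` Y)"
        unfolding sep_def
      proof
        fix b assume b: "b \<in> B"
        show "(\<forall>x\<in>g ` Y. x < b) \<or> (\<forall>x\<in>g ` Y. b < x)"
        proof (cases "b \<in> A")
          case True
          then have "(\<forall>y\<in>Y. y < f b) \<or> (\<forall>y\<in>Y. f b < y)"
            using Y(2) b unfolding sep_def C_def by blast
          moreover have "y < f b \<longleftrightarrow> g y < b" "f b < y \<longleftrightarrow> b < g y" if "y \<in> Y" for y
            using that g[of y] Y(1) pl_isoD(7)[OF f, of "g y" b] pl_isoD(7)[OF f, of b "g y"] True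
            by auto
          ultimately show ?thesis
            by blast
        next
          case False
          have "\<not> (x \<le> b \<and> b \<le> y)" if "x \<in> A" "y \<in> A" for x y
            using that A False b B(2) unfolding zconvex_def by blast
          then show ?thesis
            using gY by (meson not_less order.strict_implies_order subsetD)
        qed
      qed
    qed
  qed
  then have "pl A' g"
    unfolding pl_def using C by blast
  moreover have "g ` A' = A"
    using g gf pl_isoD(6)[OF f] by force
  moreover have "strict_mono_on A' g"
    unfolding strict_mono_on_def using g pl_isoD(7)[OF f] by metis
  ultimately show ?thesis
    by (simp add: pl_iso_def)
qed

lemma pl_iso_subset:
  assumes "pl_iso A A' f" "Y \<subseteq> A" "f ` Y = Y'"
  shows "pl_iso Y Y' f"
  using assms pl_subset monotone_on_subset[of A _ _ f Y] by (auto simp: pl_iso_def)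

lemma pl_iso_interval:
  assumes "pl_iso A A' f" "x \<in> A" "y \<in> A"
  shows "pl_iso (A \<inter> {x..y}) (A' \<inter> {f x..f y}) f"
  using assms(2,3) pl_isoD(2,6,8)[OF assms(1)] by (intro pl_iso_subset[OF assms(1)]) auto

text \<open>The domains share the point \<open>b\<close>, so monotonicity across the junction
  follows by comparison with \<open>f b\<close>. The junction is added to the breaking
  points.\<close>

lemma pl_iso_glue:
  assumes f: "pl_iso A A' f" "pl_iso C C' f" and b: "b \<in> A" "b \<in> C" "b \<in> Zq"
    and le: "\<And>x. x \<in> A \<Longrightarrow> x \<le> b" "\<And>x. x \<in> C \<Longrightarrow> b \<le> x"
  shows "pl_iso (A \<union> C) (A' \<union> C') f"
proof -
  obtain B where B: "finite B" "B \<subseteq> Zq" "\<And>Y. Y \<subseteq> A \<Longrightarrow> sep B Y \<Longrightarrow> affine_map Y f"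
    using pl_isoD(3)[OF f(1)] unfolding pl_def by blast
  obtain D where D: "finite D" "D \<subseteq> Zq" "\<And>Y. Y \<subseteq> C \<Longrightarrow> sep D Y \<Longrightarrow> affine_map Y f"
    using pl_isoD(3)[OF f(2)] unfolding pl_def by blast
  have "affine_map Y f" if Y: "Y \<subseteq> A \<union> C" "sep (insert b (B \<union> D)) Y" for Y
  proof -
    have s: "sep B Y" "sep D Y"
      using Y(2) by (auto intro: sep_mono)
    have "(\<forall>x\<in>Y. x < b) \<or> (\<forall>x\<in>Y. b < x)"
      using Y(2) by (auto simp: sep_def)
    then have "Y \<subseteq> A \<or> Y \<subseteq> C"
      using Y(1) le by force
    then show ?thesis
      using B(3) D(3) s by blast
  qed
  then have "pl (A \<union> C) f"
    unfolding pl_def using B(1,2) D(1,2) b(3) by (intro exI[of _ "insert b (B \<union> D)"]) auto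
  moreover have "strict_mono_on (A \<union> C) f"
    unfolding strict_mono_on_def
  proof (intro allI impI, elim conjE)
    fix x y assume xy: "x \<in> A \<union> C" "y \<in> A \<union> C" "x < y"
    consider "x \<in> A" "y \<in> A" | "x \<in> C" "y \<in> C" | "x \<in> A" "y \<in> C" | "x \<in> C" "y \<in> A"
      using xy by blast
    then show "f x < f y"
    proof cases
      case 3
      then have "f x \<le> f b" "f b \<le> f y" "x \<noteq> b \<or> y \<noteq> b"
        using b le xy pl_isoD(8)[OF f(1), of x b] pl_isoD(8)[OF f(2), of b y] by auto
      moreover have "f x \<noteq> f b \<or> f b \<noteq> f y"
        using 3 b \<open>x \<noteq> b \<or> y \<noteq> b\<close> pl_isoD(4)[OF f(1)] pl_isoD(4)[OF f(2)]
        by (metis inj_onD)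
      ultimately show ?thesis
        by linarith
    next
      case 4
      then show ?thesis using le xy by force
    qed (use xy pl_isoD(7)[OF f(1)] pl_isoD(7)[OF f(2)] in auto)
  qed
  ultimately show ?thesis
    using f by (simp add: pl_iso_def image_Un)
qed

text \<open>Surjectivity uses that powers of \<open>q\<close> are units of Z[1/q], so that the
  inverse affine map preserves \<open>Zq\<close> too.\<close>

lemma pl_iso_affine:
  assumes ab: "a \<le> b" and f: "\<And>x. x \<in> {a..b} \<Longrightarrow> f x = real q powi k * x + c" and c: "c \<in> Zq"
  shows "pl_iso (Zq \<inter> {a..b}) (Zq \<inter> {f a..f b}) f"
proof -
  have pos: "0 < real q powi k"
    using q_real by simp
  have "strict_mono_on (Zq \<inter> {a..b}) f"
    using pos by (auto simp: strict_mono_on_def f)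
  moreover have "f ` (Zq \<inter> {a..b}) = Zq \<inter> {f a..f b}"
  proof
    show "f ` (Zq \<inter> {a..b}) \<subseteq> Zq \<inter> {f a..f b}"
      using ab pos c by (auto simp: f intro!: Zq_add Zq_mult)
    show "Zq \<inter> {f a..f b} \<subseteq> f ` (Zq \<inter> {a..b})"
    proof
      fix y assume y: "y \<in> Zq \<inter> {f a..f b}"
      define x where "x = real q powi (- k) * (y - c)"
      have yx: "y = real q powi k * x + c"
        using right_inverse[of "real q powi k"] pos
        by (simp add: x_def power_int_minus less_imp_neq[symmetric] flip: mult.assoc del: power_int_eq_0_iff)
      have "a \<le> x" "x \<le> b"
        using y ab pos by (simp_all add: yx f)
      moreover have "x \<in> Zq"
        using y c by (auto simp: x_def intro!: Zq_mult Zq_diff)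
      ultimately show "y \<in> f ` (Zq \<inter> {a..b})"
        using yx f by (intro image_eqI[of _ _ x]) auto
    qed
  qed
  moreover have "affine_map (Zq \<inter> {a..b}) f"
    unfolding affine_map_def using f by blast
  ultimately show ?thesis
    using pl_affine by (simp add: pl_iso_def)
qed

lemma uminus_Zq: "uminus ` Zq = Zq"
  by (force intro: image_eqI[of _ _ "- x" for x])

lemma pl_iso_reflect:
  assumes f: "pl_iso A A' f"
  shows "pl_iso (uminus ` A) (uminus ` A') (\<lambda>x. - f (- x))"
proof -
  obtain B where B: "finite B" "B \<subseteq> Zq" "\<And>Y. Y \<subseteq> A \<Longrightarrow> sep B Y \<Longrightarrow> affine_map Y f"
    using pl_isoD(3)[OF f] unfolding pl_def by blast
  have "affine_map Y (\<lambda>x. - f (- x))" if Y: "Y \<subseteq> uminus ` A" "sep (uminus ` B) Y" for Y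
  proof -
    have "sep B (uminus ` Y)"
      using Y(2) unfolding sep_def by (fastforce simp: less_minus_iff minus_less_iff)
    then have "affine_map (uminus ` Y) f"
      using Y(1) by (intro B(3)) auto
    then show ?thesis
      using affine_map_reflect[of "uminus ` Y" f] by (simp add: image_image)
  qed
  moreover have "uminus ` B \<subseteq> Zq"
    using B(2) by auto
  ultimately have "pl (uminus ` A) (\<lambda>x. - f (- x))"
    unfolding pl_def using B(1) by blast
  then show ?thesis
    using f by (auto simp: pl_iso_def strict_mono_on_def image_image)
qed

end

section \<open>Groups of piecewise affine bijections\<close>

context base
begin

lemma zconvex_interval: "zconvex S \<Longrightarrow> zconvex (S \<inter> {x..y})"
  by (auto simp: zconvex_def)

lemma zconvex_subset: "zconvex S \<Longrightarrow> S \<subseteq> Zq"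
  by (simp add: zconvex_def)

lemma PA_carrier: "g \<in> carrier (PA_group q S) \<longleftrightarrow> g \<in> extensional S \<and> pl_iso S S g"
  using strict_mono_on_imp_inj_on[of S g]
  by (auto simp: PA_group_def Bij_def bij_betw_def pl_iso_def piecewise_affine_iff_pl)

lemma PA_mult_eq:
  "f \<in> carrier (PA_group q S) \<Longrightarrow> g \<in> carrier (PA_group q S) \<Longrightarrow> f \<otimes>\<^bsub>PA_group q S\<^esub> g = compose S f g"
  by (simp add: PA_group_def BijGroup_def)

lemma PA_mult:
  "f \<in> carrier (PA_group q S) \<Longrightarrow> g \<in> carrier (PA_group q S) \<Longrightarrow> x \<in> S \<Longrightarrow>
    (f \<otimes>\<^bsub>PA_group q S\<^esub> g) x = f (g x)"
  by (simp add: PA_mult_eq compose_def)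

lemma PA_one: "x \<in> S \<Longrightarrow> \<one>\<^bsub>PA_group q S\<^esub> x = x"
  by (simp add: PA_group_def BijGroup_def)

lemma PA_closed: "g \<in> carrier (PA_group q S) \<Longrightarrow> x \<in> S \<Longrightarrow> g x \<in> S"
  using pl_isoD(6)[of S S g] by (simp add: PA_carrier)

lemma PA_less:
  "g \<in> carrier (PA_group q S) \<Longrightarrow> x \<in> S \<Longrightarrow> y \<in> S \<Longrightarrow> g x < g y \<longleftrightarrow> x < y"
  using pl_isoD(7)[of S S g] by (simp add: PA_carrier)

lemma PA_le:
  "g \<in> carrier (PA_group q S) \<Longrightarrow> x \<in> S \<Longrightarrow> y \<in> S \<Longrightarrow> g x \<le> g y \<longleftrightarrow> x \<le> y"
  using pl_isoD(8)[of S S g] by (simp add: PA_carrier)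

lemma PA_eqI:
  "f \<in> carrier (PA_group q S) \<Longrightarrow> g \<in> carrier (PA_group q S) \<Longrightarrow> (\<And>x. x \<in> S \<Longrightarrow> f x = g x) \<Longrightarrow> f = g"
  by (auto simp: PA_carrier intro: extensionalityI)

lemma restrict_PA:
  assumes "pl_iso S S f"
  shows "restrict f S \<in> carrier (PA_group q S)"
  using pl_iso_cong[OF assms] by (simp add: PA_carrier)

lemma group_PA:
  assumes S: "zconvex S"
  shows "group (PA_group q S)"
proof -
  interpret Bij: group "BijGroup S"
    by (rule group_BijGroup)
  define P where "P = carrier (PA_group q S)"
  have P_iff: "f \<in> P \<longleftrightarrow> f \<in> extensional S \<and> pl_iso S S f" for f
    by (simp add: P_def PA_carrier)
  have PBij: "P \<subseteq> carrier (BijGroup S)"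
    by (auto simp: P_def PA_group_def BijGroup_def)
  have "subgroup P (BijGroup S)"
  proof (rule Bij.subgroupI[OF PBij])
    have "restrict (\<lambda>x. x) S \<in> P"
      unfolding P_def by (rule restrict_PA[OF pl_iso_id])
    then show "P \<noteq> {}" by blast
  next
    fix f assume f: "f \<in> P"
    then have fB: "f \<in> Bij S"
      using PBij by (auto simp: BijGroup_def)
    have iso: "pl_iso S S f"
      using f P_iff by blast
    have "pl_iso S S (inv_into S f)"
    proof (rule pl_iso_inv[OF iso S zconvex_subset[OF S]])
      fix y assume "y \<in> S"
      then have "y \<in> f ` S"
        using pl_isoD(2)[OF iso] by simp
      then show "inv_into S f y \<in> S \<and> f (inv_into S f y) = y"
        by (simp add: inv_into_into f_inv_into_f)
    qed
    then show "inv\<^bsub>BijGroup S\<^esub> f \<in> P"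
      unfolding P_def using fB by (simp add: inv_BijGroup restrict_PA)
  next
    fix f g assume fg: "f \<in> P" "g \<in> P"
    then have "pl_iso S S (\<lambda>x. f (g x))"
      using P_iff pl_iso_comp S zconvex_subset[OF S] by blast
    moreover have "f \<otimes>\<^bsub>BijGroup S\<^esub> g = restrict (\<lambda>x. f (g x)) S"
      using fg PBij by (auto simp: BijGroup_def compose_def)
    ultimately show "f \<otimes>\<^bsub>BijGroup S\<^esub> g \<in> P"
      unfolding P_def by (simp add: restrict_PA)
  qed
  then have "group ((BijGroup S)\<lparr>carrier := P\<rparr>)"
    by (rule Bij.subgroup_imp_group)
  then show ?thesis
    by (simp add: P_def PA_group_def)
qed

lemma PA_inv:
  assumes S: "zconvex S" and g: "g \<in> carrier (PA_group q S)" and x: "x \<in> S"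
  shows "(inv\<^bsub>PA_group q S\<^esub> g) (g x) = x" "g ((inv\<^bsub>PA_group q S\<^esub> g) x) = x"
proof -
  interpret group "PA_group q S"
    by (rule group_PA[OF S])
  show "(inv\<^bsub>PA_group q S\<^esub> g) (g x) = x" "g ((inv\<^bsub>PA_group q S\<^esub> g) x) = x"
    using PA_mult[OF inv_closed[OF g] g x] PA_mult[OF g inv_closed[OF g] x] l_inv[OF g] r_inv[OF g] PA_one[OF x]
    by simp_all
qed

text \<open>The bounds are taken in \<open>S\<close>. On the line this gives bounded support, and on
  the open interval it keeps the support away from both end points.\<close>

definition bdd :: "real set \<Rightarrow> (real \<Rightarrow> real) set" where
  "bdd S = {g \<in> carrier (PA_group q S). \<exists>x\<in>S. \<exists>y\<in>S. {t \<in> S. g t \<noteq> t} \<subseteq> {x<..<y}}"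

abbreviation BPA :: "real set \<Rightarrow> (real \<Rightarrow> real) monoid" where
  "BPA S \<equiv> (PA_group q S)\<lparr>carrier := bdd S\<rparr>"

lemma BF_eq: "BF q = BPA Zq"
  by (simp add: BF_def F_line_def bdd_def)

lemma bdd_carrier: "g \<in> bdd S \<Longrightarrow> g \<in> carrier (PA_group q S)"
  by (simp add: bdd_def)

lemma bddI:
  assumes "g \<in> carrier (PA_group q S)" "x \<in> S" "y \<in> S" "\<And>t. t \<in> S \<Longrightarrow> t \<le> x \<or> y \<le> t \<Longrightarrow> g t = t"
  shows "g \<in> bdd S"
proof -
  have "{t \<in> S. g t \<noteq> t} \<subseteq> {x<..<y}"
    using assms(4) by force
  then show ?thesis
    using assms(1-3) by (auto simp: bdd_def)
qed

lemma bddE: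
  assumes "g \<in> bdd S"
  obtains x y where "x \<in> S" "y \<in> S" "x \<le> y" "\<And>t. t \<in> S \<Longrightarrow> t \<le> x \<or> y \<le> t \<Longrightarrow> g t = t"
proof -
  obtain x y where xy: "x \<in> S" "y \<in> S" "{t \<in> S. g t \<noteq> t} \<subseteq> {x<..<y}"
    using assms by (auto simp: bdd_def)
  show thesis
    by (rule that[of x "max x y"]) (use xy in \<open>force simp: max_def\<close>)+
qed

lemma subgroup_bdd:
  assumes S: "zconvex S" and ne: "S \<noteq> {}"
  shows "subgroup (bdd S) (PA_group q S)"
proof -
  interpret group "PA_group q S"
    by (rule group_PA[OF S])
  obtain s where s: "s \<in> S"
    using ne by blast
  show ?thesis
  proof (rule subgroupI)
    show "bdd S \<subseteq> carrier (PA_group q S)"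
      by (auto simp: bdd_carrier)
    have "\<one>\<^bsub>PA_group q S\<^esub> \<in> bdd S"
      by (rule bddI[OF one_closed s s]) (rule PA_one)
    then show "bdd S \<noteq> {}" by blast
  next
    fix f assume f: "f \<in> bdd S"
    obtain x y where xy: "x \<in> S" "y \<in> S" "\<And>t. t \<in> S \<Longrightarrow> t \<le> x \<or> y \<le> t \<Longrightarrow> f t = t"
      using bddE[OF f] by metis
    have "(inv\<^bsub>PA_group q S\<^esub> f) t = t" if "t \<in> S" "t \<le> x \<or> y \<le> t" for t
      using PA_inv(1)[OF S bdd_carrier[OF f] that(1)] xy(3)[OF that] by simp
    then show "inv\<^bsub>PA_group q S\<^esub> f \<in> bdd S"
      using f bdd_carrier by (intro bddI[OF _ xy(1,2)]) auto
  next
    fix f g assume f: "f \<in> bdd S" and g: "g \<in> bdd S"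
    obtain x y where xy: "x \<in> S" "y \<in> S" "\<And>t. t \<in> S \<Longrightarrow> t \<le> x \<or> y \<le> t \<Longrightarrow> f t = t"
      using bddE[OF f] by metis
    obtain u v where uv: "u \<in> S" "v \<in> S" "\<And>t. t \<in> S \<Longrightarrow> t \<le> u \<or> v \<le> t \<Longrightarrow> g t = t"
      using bddE[OF g] by metis
    show "f \<otimes>\<^bsub>PA_group q S\<^esub> g \<in> bdd S"
    proof (rule bddI[of _ _ "min x u" "max y v"])
      show "f \<otimes>\<^bsub>PA_group q S\<^esub> g \<in> carrier (PA_group q S)"
        using f g bdd_carrier by simp
      show "min x u \<in> S" "max y v \<in> S"
        using xy uv by (auto simp: min_def max_def)
      fix t assume t: "t \<in> S" "t \<le> min x u \<or> max y v \<le> t"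
      then have "f t = t" "g t = t"
        using xy(3)[of t] uv(3)[of t] by auto
      then show "(f \<otimes>\<^bsub>PA_group q S\<^esub> g) t = t"
        using f g bdd_carrier t PA_mult by simp
    qed
  qed
qed

lemma group_BPA: "zconvex S \<Longrightarrow> S \<noteq> {} \<Longrightarrow> group (BPA S)"
  using group.subgroup_imp_group[OF group_PA subgroup_bdd] .

lemma pl_iso_extend_id:
  assumes S: "zconvex S" and xy: "x \<in> S" "y \<in> S" "x \<le> y"
    and f: "pl_iso (S \<inter> {x..y}) (S \<inter> {x..y}) f"
    and id: "\<And>t. t \<in> S \<Longrightarrow> t \<le> x \<or> y \<le> t \<Longrightarrow> f t = t"
  shows "pl_iso S S f"
proof -
  have l: "pl_iso (S \<inter> {..x}) (S \<inter> {..x}) f" and r: "pl_iso (S \<inter> {y..}) (S \<inter> {y..}) f"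
    by (rule pl_iso_cong[OF pl_iso_id]; use id in auto)+
  have "pl_iso ((S \<inter> {..x}) \<union> (S \<inter> {x..y})) ((S \<inter> {..x}) \<union> (S \<inter> {x..y})) f"
    using xy zconvex_subset[OF S] by (intro pl_iso_glue[OF l f, of x]) auto
  then have "pl_iso (((S \<inter> {..x}) \<union> (S \<inter> {x..y})) \<union> (S \<inter> {y..})) (((S \<inter> {..x}) \<union> (S \<inter> {x..y})) \<union> (S \<inter> {y..})) f"
    using xy zconvex_subset[OF S] by (intro pl_iso_glue[OF _ r, of _ _ y]) auto
  moreover have "((S \<inter> {..x}) \<union> (S \<inter> {x..y})) \<union> (S \<inter> {y..}) = S"
    using xy by auto
  ultimately show ?thesis
    by simp
qed

text \<open>
  Such a map may have infinitely many pieces, accumulating at the ends; conjugation by it still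
  preserves boundedly supported elements.
\<close>

definition local_iso :: "real set \<Rightarrow> real set \<Rightarrow> (real \<Rightarrow> real) \<Rightarrow> bool" where
  "local_iso T S p \<longleftrightarrow> p ` T = S \<and>
    (\<forall>x\<in>T. \<forall>y\<in>T. x \<le> y \<longrightarrow> pl_iso (T \<inter> {x..y}) (S \<inter> {p x..p y}) p)"

lemma local_isoD:
  assumes "local_iso T S p"
  shows "p ` T = S" "\<And>x y. x \<in> T \<Longrightarrow> y \<in> T \<Longrightarrow> x \<le> y \<Longrightarrow> pl_iso (T \<inter> {x..y}) (S \<inter> {p x..p y}) p"
    "\<And>x. x \<in> T \<Longrightarrow> p x \<in> S" "\<And>x y. x \<in> T \<Longrightarrow> y \<in> T \<Longrightarrow> p x < p y \<longleftrightarrow> x < y" "inj_on p T"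
proof -
  show 1: "p ` T = S" and 2: "\<And>x y. x \<in> T \<Longrightarrow> y \<in> T \<Longrightarrow> x \<le> y \<Longrightarrow> pl_iso (T \<inter> {x..y}) (S \<inter> {p x..p y}) p"
    using assms by (auto simp: local_iso_def)
  show "\<And>x. x \<in> T \<Longrightarrow> p x \<in> S"
    using 1 by blast
  have less: "p x < p y" if "x \<in> T" "y \<in> T" "x < y" for x y
    using pl_isoD(7)[OF 2[of x y], of x y] that by auto
  then show "\<And>x y. x \<in> T \<Longrightarrow> y \<in> T \<Longrightarrow> p x < p y \<longleftrightarrow> x < y"
    by (metis less_asym less_irrefl neq_iff)
  show "inj_on p T"
    unfolding inj_on_def using less by (metis less_irrefl neq_iff)
qed

lemma local_iso_inv:
  assumes p: "local_iso T S p" and T: "zconvex T" and S: "zconvex S"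
    and r: "\<And>y. y \<in> S \<Longrightarrow> r y \<in> T \<and> p (r y) = y"
  shows "local_iso S T r"
  unfolding local_iso_def
proof (intro conjI ballI impI)
  have rp: "r (p x) = x" if "x \<in> T" for x
    using r[of "p x"] that local_isoD(3,5)[OF p] by (auto dest: inj_onD)
  show "r ` S = T"
    using r rp local_isoD(3)[OF p] by force
  fix x y assume xy: "x \<in> S" "y \<in> S" "x \<le> y"
  have "r x \<le> r y"
    using r[OF xy(1)] r[OF xy(2)] local_isoD(4)[OF p, of "r y" "r x"] xy(3) by (metis not_less)
  then have iso: "pl_iso (T \<inter> {r x..r y}) (S \<inter> {x..y}) p"
    using local_isoD(2)[OF p, of "r x" "r y"] r xy by simp
  show "pl_iso (S \<inter> {x..y}) (T \<inter> {r x..r y}) r"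
  proof (rule pl_iso_inv[OF iso zconvex_interval[OF T]])
    show "S \<inter> {x..y} \<subseteq> Zq"
      using zconvex_subset[OF S] by blast
    fix z assume z: "z \<in> S \<inter> {x..y}"
    then have "z \<in> p ` (T \<inter> {r x..r y})"
      using pl_isoD(2)[OF iso] by simp
    then show "r z \<in> T \<inter> {r x..r y} \<and> p (r z) = z"
      using rp by auto
  qed
qed

text \<open>Only the restriction of \<open>p\<close> to the part of \<open>T\<close> over the
  support of \<open>g\<close> matters. There \<open>p\<close> has finitely many pieces, and
  elsewhere the conjugate is the identity, however many pieces \<open>p\<close> has.\<close>

lemma conj_bdd:
  assumes p: "local_iso T S p" and T: "zconvex T" and S: "zconvex S"
    and r: "\<And>y. y \<in> S \<Longrightarrow> r y \<in> T \<and> p (r y) = y" and g: "g \<in> bdd S"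
  shows "(\<lambda>t\<in>T. r (g (p t))) \<in> bdd T"
proof -
  have rp: "r (p x) = x" if "x \<in> T" for x
    using r[of "p x"] that local_isoD(3,5)[OF p] by (auto dest: inj_onD)
  have lr: "local_iso S T r"
    by (rule local_iso_inv[OF p T S r])
  obtain a b where ab: "a \<in> S" "b \<in> S" "a \<le> b" "\<And>t. t \<in> S \<Longrightarrow> t \<le> a \<or> b \<le> t \<Longrightarrow> g t = t"
    using bddE[OF g] by metis
  have gab: "g a = a" "g b = b"
    using ab by auto
  define x y where "x = r a" and "y = r b"
  have xy: "x \<in> T" "y \<in> T" "p x = a" "p y = b"
    using r ab by (auto simp: x_def y_def)
  have "x \<le> y"
    using local_isoD(4)[OF p xy(2,1)] xy ab(3) by simp
  have id: "r (g (p t)) = t" if "t \<in> T" "t \<le> x \<or> y \<le> t" for t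
  proof -
    have "p t \<le> a \<or> b \<le> p t"
      using that xy local_isoD(4)[OF p, of x t] local_isoD(4)[OF p, of t y] by auto
    then show ?thesis
      using ab(4)[of "p t"] rp that local_isoD(3)[OF p] by simp
  qed
  have 1: "pl_iso (T \<inter> {x..y}) (S \<inter> {a..b}) p"
    using local_isoD(2)[OF p xy(1,2) \<open>x \<le> y\<close>] xy by simp
  have 2: "pl_iso (S \<inter> {a..b}) (S \<inter> {a..b}) g"
    using pl_iso_interval[of S S g a b] bdd_carrier[OF g] ab gab by (simp add: PA_carrier)
  have 3: "pl_iso (S \<inter> {a..b}) (T \<inter> {x..y}) r"
    using local_isoD(2)[OF lr ab(1-3)] by (simp add: x_def y_def)
  have sub: "T \<inter> {x..y} \<subseteq> Zq"
    using zconvex_subset[OF T] by blast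
  have "pl_iso (T \<inter> {x..y}) (T \<inter> {x..y}) (\<lambda>t. r (g (p t)))"
    using pl_iso_comp[OF pl_iso_comp[OF 1 2 sub zconvex_interval[OF S]] 3 sub zconvex_interval[OF S]] .
  then have "pl_iso T T (\<lambda>t. r (g (p t)))"
    using pl_iso_extend_id[OF T xy(1,2) \<open>x \<le> y\<close>] id by blast
  then show ?thesis
    using id by (intro bddI[OF restrict_PA xy(1,2)]) auto
qed

lemma conj_iso:
  assumes p: "local_iso T S p" and T: "zconvex T" and S: "zconvex S"
    and r: "\<And>y. y \<in> S \<Longrightarrow> r y \<in> T \<and> p (r y) = y"
  shows "(\<lambda>g. \<lambda>t\<in>T. r (g (p t))) \<in> iso (BPA S) (BPA T)"
proof -
  let ?h = "\<lambda>g. \<lambda>t\<in>T. r (g (p t))"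
  let ?k = "\<lambda>g. \<lambda>s\<in>S. p (g (r s))"
  have rp: "r (p x) = x" if "x \<in> T" for x
    using r[of "p x"] that local_isoD(3,5)[OF p] by (auto dest: inj_onD)
  have pT: "p x \<in> S" if "x \<in> T" for x
    using local_isoD(3)[OF p that] .
  have h: "?h g \<in> bdd T" if "g \<in> bdd S" for g
    using conj_bdd[OF p T S r that] .
  have k: "?k g \<in> bdd S" if "g \<in> bdd T" for g
    using rp pT by (intro conj_bdd[OF local_iso_inv[OF p T S r] S T _ that]) auto
  have hk: "?h (?k g) = g" if "g \<in> bdd T" for g
    using that pT rp PA_closed[of g T]
    by (intro PA_eqI[of _ T] bdd_carrier[OF h[OF k]] bdd_carrier) (auto dest: bdd_carrier)
  have kh: "?k (?h g) = g" if "g \<in> bdd S" for g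
    using that r PA_closed[of g S]
    by (intro PA_eqI[of _ S] bdd_carrier[OF k[OF h]] bdd_carrier) (auto dest: bdd_carrier)
  have "bij_betw ?h (bdd S) (bdd T)"
    by (rule bij_betw_byWitness[where f' = ?k]) (use hk kh h k in auto)
  moreover have "?h (f \<otimes>\<^bsub>PA_group q S\<^esub> g) = ?h f \<otimes>\<^bsub>PA_group q T\<^esub> ?h g"
    if fg: "f \<in> bdd S" "g \<in> bdd S" for f g
  proof -
    interpret GT: group "PA_group q T" by (rule group_PA[OF T])
    have c: "?h f \<in> carrier (PA_group q T)" "?h g \<in> carrier (PA_group q T)"
      using h fg bdd_carrier by blast+
    have e: "?h (f \<otimes>\<^bsub>PA_group q S\<^esub> g) x = (?h f \<otimes>\<^bsub>PA_group q T\<^esub> ?h g) x" if "x \<in> T" for x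
      using that fg c r pT[OF that] PA_closed[of g S "p x"]
      by (simp add: PA_mult bdd_carrier)
    have "?h f \<otimes>\<^bsub>PA_group q T\<^esub> ?h g \<in> extensional T"
      using GT.m_closed[OF c] PA_carrier by blast
    then show ?thesis
      using e by (intro extensionalityI[of _ T]) auto
  qed
  ultimately show ?thesis
    by (auto simp: iso_def hom_def bij_betw_def)
qed

end

section \<open>Contractions and proximality\<close>

context base
begin

lemma zconvex_Zq: "zconvex Zq"
  by (simp add: zconvex_def)

text \<open>An interval of length \<open>c\<close> is contracted by the factor \<open>q\<close>, and
  the next one, of length \<open>c / q\<close>, is expanded by \<open>q\<close>. The two lengths are
  exchanged, so the map returns to the identity at \<open>p + c + c / q\<close>.\<close>

definition bump :: "real \<Rightarrow> real \<Rightarrow> real \<Rightarrow> real" where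
  "bump p c x = (if x \<le> p \<or> p + c + c / real q \<le> x then x
    else if x \<le> p + c then p + (x - p) / real q else p + c / real q + real q * (x - p - c))"

lemma bump_contract: "p \<le> x \<Longrightarrow> x \<le> p + c \<Longrightarrow> 0 < c \<Longrightarrow> bump p c x = p + (x - p) / real q"
proof -
  assume x: "p \<le> x" "x \<le> p + c" and c: "0 < c"
  have "0 < c / real q"
    using c q_real by (intro divide_pos_pos) auto
  then have "\<not> p + c + c / real q \<le> x"
    using x by linarith
  then show ?thesis
    using x by (auto simp: bump_def)
qed

lemma pl_iso_bump:
  assumes p: "p \<in> Zq" and c: "c \<in> Zq" "0 < c"
  shows "pl_iso Zq Zq (bump p c)"
proof -
  define s where "s = p + c"
  define e where "e = p + c + c / real q"
  have cq: "0 < c / real q"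
    using c q_real by simp
  have Z: "s \<in> Zq" "e \<in> Zq" "p - p / real q \<in> Zq" "p + c / real q - real q * s \<in> Zq"
    using p c by (auto simp: s_def e_def intro!: Zq_add Zq_diff Zq_mult Zq_divide)
  have order: "p \<le> s" "s \<le> e" "p \<le> e"
    using c cq by (auto simp: s_def e_def)
  have vals: "bump p c p = p" "bump p c s = p + c / real q" "bump p c e = e"
    using c cq by (auto simp: bump_def s_def e_def)
  have 1: "bump p c x = real q powi (- 1) * x + (p - p / real q)" if "x \<in> {p..s}" for x
    using that c bump_contract[of p x c] by (simp add: s_def diff_divide_distrib power_int_minus field_simps)
  have 2: "bump p c x = real q powi 1 * x + (p + c / real q - real q * s)" if "x \<in> {s..e}" for x
  proof -
    consider "x = s" | "x = e" | "s < x" "x < e"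
      using \<open>x \<in> {s..e}\<close> by fastforce
    then show ?thesis
    proof cases
      case 2
      have "real q * e = real q * s + c"
        using q_real by (simp add: s_def e_def distrib_left)
      then show ?thesis
        using 2 vals by (simp add: e_def)
    next
      case 3
      then show ?thesis
        using c cq by (auto simp: bump_def s_def e_def algebra_simps)
    qed (use vals in simp)
  qed
  have l: "pl_iso (Zq \<inter> {p..s}) (Zq \<inter> {p..p + c / real q}) (bump p c)"
    using pl_iso_affine[OF order(1) 1 Z(3)] vals by simp
  have r: "pl_iso (Zq \<inter> {s..e}) (Zq \<inter> {p + c / real q..e}) (bump p c)"
    using pl_iso_affine[OF order(2) 2 Z(4)] vals by simp
  have "pl_iso (Zq \<inter> {p..s} \<union> Zq \<inter> {s..e}) (Zq \<inter> {p..p + c / real q} \<union> Zq \<inter> {p + c / real q..e}) (bump p c)"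
    using Z order by (intro pl_iso_glue[OF l r, of s]) auto
  moreover have "Zq \<inter> {p..s} \<union> Zq \<inter> {s..e} = Zq \<inter> {p..e}"
    using order by auto
  moreover have "Zq \<inter> {p..p + c / real q} \<union> Zq \<inter> {p + c / real q..e} = Zq \<inter> {p..e}"
    using cq c by (auto simp: e_def)
  ultimately have "pl_iso (Zq \<inter> {p..e}) (Zq \<inter> {p..e}) (bump p c)"
    by simp
  then show ?thesis
    using p Z order by (intro pl_iso_extend_id[OF zconvex_Zq p Z(2) order(3)]) (auto simp: bump_def e_def)
qed

lemma BPA_Zq_contraction:
  assumes p: "p \<in> Zq" and c: "c \<in> Zq" "0 < c"
  shows "\<exists>g\<in>bdd Zq. \<forall>x\<in>Zq. p \<le> x \<longrightarrow> x \<le> p + c \<longrightarrow> g x = p + (x - p) / real q ^ n"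
proof -
  interpret B: group "BPA Zq"
    by (rule group_BPA[OF zconvex_Zq]) (use p in auto)
  define s where "s = restrict (bump p c) Zq"
  have s_eq: "s x = p + (x - p) / real q" if "x \<in> Zq" "p \<le> x" "x \<le> p + c" for x
    using that bump_contract c by (simp add: s_def)
  have e: "p + c + c / real q \<in> Zq"
    using p c by (auto intro!: Zq_add Zq_divide)
  have s: "s \<in> bdd Zq"
    unfolding s_def
    by (rule bddI[OF restrict_PA[OF pl_iso_bump[OF assms]] p e]) (auto simp: bump_def)
  have pow: "s [^]\<^bsub>BPA Zq\<^esub> m \<in> bdd Zq" for m :: nat
    using B.nat_pow_closed[of s m] s by simp
  have "(s [^]\<^bsub>BPA Zq\<^esub> n) x = p + (x - p) / real q ^ n" if "x \<in> Zq" "p \<le> x" "x \<le> p + c" for x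
    using that
  proof (induction n arbitrary: x)
    case 0
    then show ?case
      using PA_one[of x Zq] by simp
  next
    case (Suc n)
    have "(x - p) / real q \<le> x - p"
      using Suc.prems q_real by (simp add: divide_le_eq mult_le_cancel_left1)
    then have sx: "p \<le> s x" "s x \<le> p + c"
      using Suc.prems s_eq q_real by auto
    have sZ: "s x \<in> Zq"
      by (rule PA_closed[OF bdd_carrier[OF s] Suc.prems(1)])
    have "(s [^]\<^bsub>BPA Zq\<^esub> Suc n) x = (s [^]\<^bsub>BPA Zq\<^esub> n) (s x)"
      using PA_mult[OF bdd_carrier[OF pow] bdd_carrier[OF s] Suc.prems(1), of n]
      by (simp add: B.nat_pow_Suc)
    then show ?case
      using Suc.IH[OF sZ sx] s_eq[OF Suc.prems] by simp
  qed
  then show ?thesis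
    using pow[of n] by blast
qed

text \<open>If \<open>c < a\<close>, a strong contraction towards a point \<open>p\<close> between
  \<open>c\<close> and \<open>min a d\<close> brings \<open>b\<close> below \<open>d\<close> and
  keeps \<open>a\<close> above \<open>p\<close>. Otherwise the interval is first lifted above
  \<open>c\<close>: a contraction towards a point below \<open>a\<close> and \<open>c\<close> takes
  \<open>c\<close> below \<open>a\<close>, so its inverse takes \<open>a\<close> above
  \<open>c\<close>.\<close>

lemma BPA_Zq_proximal:
  assumes Z: "a \<in> Zq" "b \<in> Zq" "c \<in> Zq" "d \<in> Zq" and ab: "a < b" and cd: "c < d"
  shows "\<exists>g\<in>bdd Zq. c < g a \<and> g b < d"
proof -
  have S: "subgroup (bdd Zq) (PA_group q Zq)"
    by (rule subgroup_bdd[OF zconvex_Zq]) (use Z in auto)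
  have contract: "\<exists>g\<in>bdd Zq. c < g a \<and> g b < d"
    if Z: "a \<in> Zq" "b \<in> Zq" and "a < b" "c < a" for a b
  proof -
    obtain p where p: "p \<in> Zq" "c < p" "p < min a d"
      using Zq_dense[of c "min a d"] \<open>c < a\<close> cd by auto
    have "0 < (d - p) / (b - p)"
      using p \<open>a < b\<close> by (intro divide_pos_pos) auto
    then obtain n where n: "1 / real q ^ n < (d - p) / (b - p)"
      using small_inverse_power by blast
    obtain g where g: "g \<in> bdd Zq" "\<And>x. x \<in> Zq \<Longrightarrow> p \<le> x \<Longrightarrow> x \<le> p + (b - p) \<Longrightarrow> g x = p + (x - p) / real q ^ n"
      using BPA_Zq_contraction[of p "b - p" n] p Z \<open>a < b\<close> by auto
    have "g a = p + (a - p) / real q ^ n" "g b = p + (b - p) / real q ^ n"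
      using g(2) Z p \<open>a < b\<close> by auto
    moreover have "0 < (a - p) / real q ^ n"
      using p q_real by simp
    moreover have "(b - p) / real q ^ n < d - p"
      using n p \<open>a < b\<close> by (simp add: field_simps)
    ultimately have "c < g a \<and> g b < d"
      using p by auto
    then show ?thesis
      using g(1) by blast
  qed
  show ?thesis
  proof (cases "c < a")
    case True
    then show ?thesis using contract Z ab by blast
  next
    case False
    define p where "p = a - 1"
    have p: "p \<in> Zq" "p < a" "p < c"
      using Z False by (auto simp: p_def)
    have "0 < (a - p) / (c + 1 - p)"
      using p by (intro divide_pos_pos) auto
    then obtain n where n: "1 / real q ^ n < (a - p) / (c + 1 - p)"
      using small_inverse_power by blast
    have c1: "c + 1 \<in> Zq" "c + 1 - p \<in> Zq" "0 < c + 1 - p"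
      using p Z by (auto intro!: Zq_add Zq_diff)
    obtain g where g: "g \<in> bdd Zq" "\<And>x. x \<in> Zq \<Longrightarrow> p \<le> x \<Longrightarrow> x \<le> p + (c + 1 - p) \<Longrightarrow> g x = p + (x - p) / real q ^ n"
      using BPA_Zq_contraction[of p "c + 1 - p" n] p(1) c1(2,3) by auto
    have gc: "g c = p + (c - p) / real q ^ n"
      using g(2)[of c] p Z by auto
    have "(c - p) / real q ^ n \<le> (c + 1 - p) / real q ^ n"
      using q_real by (simp add: divide_right_mono)
    also have "\<dots> < a - p"
      using n p by (simp add: field_simps)
    finally have "g c < a"
      using gc by simp
    define k where "k = inv\<^bsub>PA_group q Zq\<^esub> g"
    have gP: "g \<in> carrier (PA_group q Zq)"
      by (rule bdd_carrier[OF g(1)])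
    have k: "k \<in> bdd Zq" "k \<in> carrier (PA_group q Zq)"
      using subgroup.m_inv_closed[OF S g(1)] bdd_carrier by (auto simp: k_def)
    have gk: "g (k x) = x" if "x \<in> Zq" for x
      using PA_inv(2)[OF zconvex_Zq gP that] by (simp add: k_def)
    have kZ: "k a \<in> Zq" "k b \<in> Zq"
      using PA_closed[OF k(2)] Z by auto
    have "c < k a"
      using \<open>g c < a\<close> PA_less[OF gP Z(3) kZ(1)] gk[OF Z(1)] by simp
    moreover have "k a < k b"
      using PA_less[OF k(2) Z(1,2)] ab by simp
    ultimately obtain h where h: "h \<in> bdd Zq" "c < h (k a)" "h (k b) < d"
      using contract[OF kZ] by blast
    have "h \<otimes>\<^bsub>PA_group q Zq\<^esub> k \<in> bdd Zq"
      by (rule subgroup.m_closed[OF S h(1) k(1)])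
    then show ?thesis
      using h PA_mult[OF bdd_carrier[OF h(1)] k(2)] Z by (intro bexI) auto
  qed
qed

lemma proximal_action_BPA_Zq: "proximal_action (BPA Zq) Zq (\<lambda>g. g)"
proof -
  have "Zq \<noteq> {}"
    using Zq_consts by blast
  then have B: "group (BPA Zq)"
    by (rule group_BPA[OF zconvex_Zq])
  have PA: "g \<in> carrier (PA_group q Zq)" if "g \<in> carrier (BPA Zq)" for g
    using that bdd_carrier by simp
  show ?thesis
  proof (rule proximal_action.intro[OF B proximal_action_axioms.intro], goal_cases)
    case (1 g x)
    then show ?case using PA_closed[OF PA] by blast
  next
    case (2 g h x)
    then show ?case using PA_mult[OF PA PA, of g h x] by simp
  next
    case (3 g)
    have "\<one>\<^bsub>PA_group q Zq\<^esub> \<in> carrier (PA_group q Zq)"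
      using group_PA[OF zconvex_Zq] by (simp add: group.is_monoid monoid.one_closed)
    then have "g = \<one>\<^bsub>PA_group q Zq\<^esub>"
      using PA[OF 3(1)] 3(2) PA_one by (intro PA_eqI[of g Zq]) auto
    then show ?case by simp
  next
    case (4 g x y)
    then show ?case using PA_less[OF PA] by blast
  next
    case (5 g)
    then have "g \<in> bdd Zq" by simp
    then obtain x y where xy: "x \<in> Zq" "y \<in> Zq" "x \<le> y" "\<And>t. t \<in> Zq \<Longrightarrow> t \<le> x \<or> y \<le> t \<Longrightarrow> g t = t"
      using bddE by metis
    \<comment> \<open>The bounds from \<open>bddE\<close> may coincide; \<open>y + 1\<close> makes
      the interval nondegenerate.\<close>
    have "x < t \<and> t < y + 1" if "t \<in> Zq" "g t \<noteq> t" for t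
      using xy(4)[OF that(1)] that(2) by fastforce
    moreover have "y + 1 \<in> Zq" "x < y + 1"
      using xy by auto
    ultimately show ?case
      using xy(1) by blast
  next
    case (6 a b c d)
    then show ?case using BPA_Zq_proximal by simp
  qed
qed

end

section \<open>The interval and the line\<close>

lemma (in base) pl_iso_image_interval:
  assumes "pl_iso (Zq \<inter> {a..b}) (Zq \<inter> {c..d}) f" "\<And>x. x \<in> Zq \<Longrightarrow> a \<le> x \<Longrightarrow> x \<le> b \<Longrightarrow> f x = g x"
    "a = a'" "b = b'" "c = c'" "d = d'"
  shows "pl_iso (Zq \<inter> {a'..b'}) (Zq \<inter> {c'..d'}) g"
  using pl_iso_cong[OF assms(1), of g] assms(2-6) by simp

lemma (in base) pl_iso_glue_interval:
  assumes "pl_iso (Zq \<inter> {a..b}) (Zq \<inter> {a'..b'}) f" "pl_iso (Zq \<inter> {b..c}) (Zq \<inter> {b'..c'}) f"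
    and "b \<in> Zq" "a \<le> b" "b \<le> c" "a' \<le> b'" "b' \<le> c'"
  shows "pl_iso (Zq \<inter> {a..c}) (Zq \<inter> {a'..c'}) f"
proof -
  have "pl_iso (Zq \<inter> {a..b} \<union> Zq \<inter> {b..c}) (Zq \<inter> {a'..b'} \<union> Zq \<inter> {b'..c'}) f"
    using assms by (intro pl_iso_glue[of _ _ _ _ _ b]) auto
  moreover have "Zq \<inter> {a..b} \<union> Zq \<inter> {b..c} = Zq \<inter> {a..c}" "Zq \<inter> {a'..b'} \<union> Zq \<inter> {b'..c'} = Zq \<inter> {a'..c'}"
    using assms(4-7) by auto
  ultimately show ?thesis
    by simp
qed

lemma (in base) pl_iso_comp_interval:
  assumes "pl_iso (Zq \<inter> {a..b}) (Zq \<inter> {c..d}) f" "pl_iso (Zq \<inter> {c..d}) (Zq \<inter> {u..v}) g"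
  shows "pl_iso (Zq \<inter> {a..b}) (Zq \<inter> {u..v}) (\<lambda>x. g (f x))"
  using assms by (rule pl_iso_comp) (auto intro: zconvex_interval zconvex_Zq)

lemma (in base) pl_iso_reflect_interval:
  assumes "pl_iso (Zq \<inter> {a..b}) (Zq \<inter> {c..d}) f"
  shows "pl_iso (Zq \<inter> {-b..-a}) (Zq \<inter> {-d..-c}) (\<lambda>x. - f (- x))"
proof -
  have "uminus ` (Zq \<inter> {a..b}) = Zq \<inter> {-b..-a}" for a b
    using uminus_Zq by (simp add: image_Int)
  then show ?thesis
    using pl_iso_reflect[OF assms] by simp
qed

locale interval_line = base +
  fixes r :: nat
  assumes r: "1 \<le> r"
begin

abbreviation S :: "real set" where
  "S \<equiv> {0<..<of_nat r} \<inter> Zq"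

lemma zconvex_S: "zconvex S"
  by (auto simp: zconvex_def)

text \<open>
  The nonpositive half-line is cut into intervals of length \<open>q - 1\<close>; the one with index \<open>m\<close> is mapped
  affinely, with slope \<open>q\<close> to the power \<open>- (m + 1)\<close>, onto the interval between the powers of \<open>q\<close>
  with exponents \<open>- (m + 1)\<close> and \<open>- m\<close>.
\<close>

definition left :: "real \<Rightarrow> real" where
  "left y = (let m = nat \<lfloor>- y / (real q - 1)\<rfloor> in (1 + (y + real m * (real q - 1)) / real q) / real q ^ m)"

text \<open>At the left end point the floor already selects the next piece. The two formulas agree
  there, both giving 1 / q^(m+1), so each formula is valid on its closed interval, as gluing
  requires.\<close>

lemma left_piece:
  assumes "- real (Suc m) * (real q - 1) \<le> y" "y \<le> - real m * (real q - 1)"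
  shows "left y = (1 + (y + real m * (real q - 1)) / real q) / real q ^ m"
proof (cases "y = - real (Suc m) * (real q - 1)")
  case True
  then have "- y / (real q - 1) = real (Suc m)"
    using q_real by simp
  then have "nat \<lfloor>- y / (real q - 1)\<rfloor> = Suc m"
    by simp
  moreover have "y + real (Suc m) * (real q - 1) = 0"
    using True by (simp add: algebra_simps)
  ultimately have "left y = 1 / real q ^ Suc m"
    by (simp only: left_def Let_def) simp
  moreover have "y + real m * (real q - 1) = - (real q - 1)"
    using True by (simp add: algebra_simps)
  then have "(1 + (y + real m * (real q - 1)) / real q) / real q ^ m = 1 / real q ^ Suc m"
    using q_real by (simp add: diff_divide_distrib)
  ultimately show ?thesis
    by simp
next
  case False
  have pos: "0 < real q - 1"
    using q_real by simp
  have "real m * (real q - 1) \<le> - y" "- y < (real m + 1) * (real q - 1)"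
    using assms False by (simp_all add: algebra_simps)
  then have "real m \<le> - y / (real q - 1)" "- y / (real q - 1) < real m + 1"
    using pos_le_divide_eq[OF pos] pos_divide_less_eq[OF pos] by blast+
  then have "\<lfloor>- y / (real q - 1)\<rfloor> = int m"
    by (simp add: floor_eq_iff)
  then show ?thesis
    by (simp add: left_def)
qed

lemma left_at: "left (- real m * (real q - 1)) = 1 / real q ^ m"
  using left_piece[of m "- real m * (real q - 1)"] q_real by (simp add: algebra_simps)

lemma left_iso: "pl_iso (Zq \<inter> {- real m * (real q - 1)..0}) (Zq \<inter> {1 / real q ^ m..1}) left"
proof (induction m)
  case 0
  have "left x = real q powi 0 * x + 1" if "x \<in> {0..0}" for x
    using that left_at[of 0] by simp
  then have "pl_iso (Zq \<inter> {0..0}) (Zq \<inter> {left 0..left 0}) left"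
    by (intro pl_iso_affine[of 0 0 left 0 1]) auto
  then show ?case
    using left_at[of 0] by simp
next
  case (Suc m)
  let ?c = "(1 + real m * (real q - 1) / real q) / real q ^ m"
  have "left x = real q powi (- int (Suc m)) * x + ?c"
    if "x \<in> {- real (Suc m) * (real q - 1)..- real m * (real q - 1)}" for x
  proof -
    have "left x = (1 + (x + real m * (real q - 1)) / real q) / real q ^ m"
      using that by (intro left_piece) auto
    also have "\<dots> = x / real q ^ Suc m + ?c"
      by (simp add: add_divide_distrib)
    also have "real q powi (- int (Suc m)) = 1 / real q ^ Suc m"
      by (simp only: power_int_minus power_int_of_nat) (simp add: inverse_eq_divide)
    then have "x / real q ^ Suc m = real q powi (- int (Suc m)) * x"
      by simp
    finally show ?thesis .
  qed
  moreover have "?c \<in> Zq"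
    by (intro Zq_divide_power Zq_add Zq_divide Zq_mult Zq_diff) auto
  moreover have mono: "- real (Suc m) * (real q - 1) \<le> - real m * (real q - 1)"
    using q_real by (intro mult_right_mono) auto
  ultimately have "pl_iso (Zq \<inter> {- real (Suc m) * (real q - 1)..- real m * (real q - 1)})
      (Zq \<inter> {1 / real q ^ Suc m..1 / real q ^ m}) left"
    using pl_iso_affine[of "- real (Suc m) * (real q - 1)" "- real m * (real q - 1)" left] left_at by metis
  then show ?case
  proof (rule pl_iso_glue_interval[OF _ Suc.IH _ mono])
    show "- real m * (real q - 1) \<in> Zq"
      by (intro Zq_mult Zq_minus Zq_diff) auto
    show "- real m * (real q - 1) \<le> 0"
      using q_real by (intro mult_nonpos_nonneg) auto
    show "1 / real q ^ Suc m \<le> 1 / real q ^ m"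
      using q_real by (intro divide_left_mono power_increasing) auto
    show "1 / real q ^ m \<le> 1"
      using q_real by (simp add: divide_le_eq)
  qed
qed

text \<open>After a shift and division by \<open>q\<close>, \<open>left\<close> compresses the
  half-line below 1/q onto (0, 1/q]; the other end is its mirror image, and the identity joins them.
  Since q \<ge> 2 and r \<ge> 1, the two end regions meet in at most one point.\<close>

definition to_interval :: "real \<Rightarrow> real" where
  "to_interval y = (if y \<le> 1 / real q then left (y - 1 / real q) / real q
    else if real r - 1 / real q \<le> y then real r - left (real r - 1 / real q - y) / real q else y)"

text \<open>The point of the line that \<open>to_interval\<close> sends to 1 / q^(m+1). The windows
  from \<open>lo m\<close> to \<open>r - lo m\<close> exhaust the line.\<close>

definition lo :: "nat \<Rightarrow> real" where
  "lo m = 1 / real q - real m * (real q - 1)"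

lemma lo_le: "lo m \<le> 1 / real q"
  using q_real by (simp add: lo_def)

lemma inverse_q: "1 / real q \<in> Zq" "1 / real q \<le> real r - 1 / real q"
proof -
  show "1 / real q \<in> Zq"
    using Zq_inverse_power[of 1] by simp
  have "2 \<le> real q" "1 \<le> real r"
    using q r by auto
  then have "1 / real q \<le> 1 / 2"
    by (intro divide_left_mono) auto
  then show "1 / real q \<le> real r - 1 / real q"
    using \<open>1 \<le> real r\<close> by linarith
qed

lemma to_interval_left:
  "pl_iso (Zq \<inter> {lo m..1 / real q}) (Zq \<inter> {1 / real q ^ Suc m..1 / real q}) to_interval"
proof -
  have "pl_iso (Zq \<inter> {lo m..1 / real q}) (Zq \<inter> {- real m * (real q - 1)..0}) (\<lambda>y. y - 1 / real q)"
    by (rule pl_iso_image_interval[OF pl_iso_affine[where k = 0 and c = "- (1 / real q)" and f = "\<lambda>y. y - 1 / real q", OF lo_le]])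
      (use inverse_q in \<open>auto simp: lo_def\<close>)
  from pl_iso_comp_interval[OF this left_iso]
  have 1: "pl_iso (Zq \<inter> {lo m..1 / real q}) (Zq \<inter> {1 / real q ^ m..1}) (\<lambda>y. left (y - 1 / real q))" .
  have le: "1 / real q ^ m \<le> 1"
    using q_real by (simp add: divide_le_eq)
  have "pl_iso (Zq \<inter> {1 / real q ^ m..1}) (Zq \<inter> {1 / real q ^ Suc m..1 / real q}) (\<lambda>x. x / real q)"
    by (rule pl_iso_image_interval[OF pl_iso_affine[where k = "- 1" and c = 0 and f = "\<lambda>x. x / real q", OF le]])
      (auto simp: power_int_minus divide_inverse)
  from pl_iso_comp_interval[OF 1 this] show ?thesis
    by (rule pl_iso_image_interval) (auto simp: to_interval_def)
qed

lemma to_interval_symmetric: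
  assumes "real r - 1 / real q \<le> y"
  shows "to_interval y = real r - to_interval (real r - y)"
proof (cases "y \<le> 1 / real q")
  \<comment> \<open>Here \<open>1 / q\<close> and \<open>r - 1 / q\<close> coincide, that is, q = 2
    and r = 1. The first branch of \<open>to_interval\<close> takes precedence, so the common point
    is checked by hand.\<close>
  case True
  then have y: "y = 1 / real q" "real r - y = 1 / real q"
    using assms inverse_q by auto
  have "to_interval (1 / real q) = 1 / real q"
    using left_at[of 0] by (simp add: to_interval_def)
  then show ?thesis
    using y by simp
next
  case False
  then show ?thesis
    using assms by (simp add: to_interval_def algebra_simps)
qed

lemma to_interval_right:
  "pl_iso (Zq \<inter> {real r - 1 / real q..real r - lo m})
    (Zq \<inter> {real r - 1 / real q..real r - 1 / real q ^ Suc m}) to_interval"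
proof -
  have 1: "pl_iso (Zq \<inter> {real r - 1 / real q..real r - lo m}) (Zq \<inter> {- (1 / real q)..- lo m}) (\<lambda>y. y - real r)"
    by (rule pl_iso_image_interval[OF pl_iso_affine[where a = "real r - 1 / real q" and b = "real r - lo m"
          and k = 0 and c = "- real r" and f = "\<lambda>y. y - real r"]])
      (use lo_le in auto)
  have 2: "pl_iso (Zq \<inter> {- (1 / real q)..- (1 / real q ^ Suc m)})
      (Zq \<inter> {real r - 1 / real q..real r - 1 / real q ^ Suc m}) (\<lambda>y. y + real r)"
    by (rule pl_iso_image_interval[OF pl_iso_affine[where a = "- (1 / real q)" and b = "- (1 / real q ^ Suc m)"
          and k = 0 and c = "real r" and f = "\<lambda>y. y + real r"]])
      (use q_real in \<open>auto simp: divide_le_eq\<close>)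
  from pl_iso_comp_interval[OF pl_iso_comp_interval[OF 1 pl_iso_reflect_interval[OF to_interval_left]] 2]
  show ?thesis
    by (rule pl_iso_image_interval) (use to_interval_symmetric in auto)
qed

lemma to_interval_middle:
  "pl_iso (Zq \<inter> {1 / real q..real r - 1 / real q}) (Zq \<inter> {1 / real q..real r - 1 / real q}) to_interval"
proof -
  have "to_interval (1 / real q) = 1 / real q"
    using left_at[of 0] by (simp add: to_interval_def)
  moreover from this have "to_interval (real r - 1 / real q) = real r - 1 / real q"
    using to_interval_symmetric[of "real r - 1 / real q"] by simp
  ultimately have "to_interval x = x" if "1 / real q \<le> x" "x \<le> real r - 1 / real q" for x
    using that by (cases "x = 1 / real q"; cases "x = real r - 1 / real q") (auto simp: to_interval_def)
  then show ?thesis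
    by (intro pl_iso_image_interval[OF pl_iso_affine[where k = 0 and c = 0 and f = "\<lambda>x. x", OF inverse_q(2)]]) auto
qed

lemma to_interval_iso:
  "pl_iso (Zq \<inter> {lo m..real r - lo m}) (Zq \<inter> {1 / real q ^ Suc m..real r - 1 / real q ^ Suc m}) to_interval"
proof -
  have le: "1 / real q ^ Suc m \<le> 1 / real q"
    using q_real by (simp add: divide_le_eq)
  have "pl_iso (Zq \<inter> {lo m..real r - 1 / real q}) (Zq \<inter> {1 / real q ^ Suc m..real r - 1 / real q}) to_interval"
    by (rule pl_iso_glue_interval[OF to_interval_left to_interval_middle inverse_q(1) lo_le inverse_q(2) le inverse_q(2)])
  then show ?thesis
    by (rule pl_iso_glue_interval[OF _ to_interval_right])
      (use inverse_q lo_le[of m] le in \<open>auto intro!: Zq_diff\<close>)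
qed

lemma lo_covers: "\<exists>m. lo m \<le> x \<and> x \<le> real r - lo m \<and> lo m \<le> y \<and> y \<le> real r - lo m"
proof -
  obtain m :: nat where m: "(\<bar>x\<bar> + \<bar>y\<bar> + 1) / (real q - 1) < real m"
    using reals_Archimedean2 by blast
  then have "\<bar>x\<bar> + \<bar>y\<bar> + 1 < real m * (real q - 1)"
    using q_real by (simp add: divide_less_eq)
  moreover have "1 / real q \<le> 1"
    using q_real by simp
  ultimately show ?thesis
    unfolding lo_def by (intro exI[of _ m]) linarith
qed

text \<open>On each window the map has finitely many pieces. The windows exhaust the line, and their
  images exhaust the open interval because 1 / q^(m+1) tends to 0.\<close>

lemma local_iso_to_interval: "local_iso Zq S to_interval"
  unfolding local_iso_def
proof (intro conjI ballI impI)
  have sub: "Zq \<inter> {1 / real q ^ Suc m..real r - 1 / real q ^ Suc m} \<subseteq> S" for m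
  proof -
    define e where "e = 1 / real q ^ Suc m"
    have "0 < e"
      unfolding e_def using q_real by (intro divide_pos_pos) auto
    then show ?thesis
      unfolding e_def[symmetric] by auto
  qed
  show "to_interval ` Zq = S"
  proof
    show "to_interval ` Zq \<subseteq> S"
    proof
      fix z assume "z \<in> to_interval ` Zq"
      then obtain y where y: "y \<in> Zq" "z = to_interval y"
        by blast
      obtain m where "lo m \<le> y" "y \<le> real r - lo m"
        using lo_covers by blast
      then have "z \<in> Zq \<inter> {1 / real q ^ Suc m..real r - 1 / real q ^ Suc m}"
        unfolding y(2) using y(1) by (intro pl_isoD(6)[OF to_interval_iso]) auto
      then show "z \<in> S"
        using sub[of m] by (rule rev_subsetD)
    qed
    show "S \<subseteq> to_interval ` Zq"
    proof
      fix z assume z: "z \<in> S"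
      obtain m where m: "1 / real q ^ m < min z (real r - z)"
        using small_inverse_power[of "min z (real r - z)"] z by auto
      have "1 / real q ^ Suc m \<le> 1 / real q ^ m"
        using q_real by (intro divide_left_mono) auto
      then have "z \<in> Zq \<inter> {1 / real q ^ Suc m..real r - 1 / real q ^ Suc m}"
        using m z by auto
      then show "z \<in> to_interval ` Zq"
        using pl_isoD(2)[OF to_interval_iso[of m]] by blast
    qed
  qed
  fix x y assume xy: "x \<in> Zq" "y \<in> Zq" "x \<le> y"
  obtain m where m: "lo m \<le> x" "x \<le> real r - lo m" "lo m \<le> y" "y \<le> real r - lo m"
    using lo_covers by blast
  have in_S: "to_interval x \<in> Zq \<inter> {1 / real q ^ Suc m..real r - 1 / real q ^ Suc m}"
      "to_interval y \<in> Zq \<inter> {1 / real q ^ Suc m..real r - 1 / real q ^ Suc m}"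
    using pl_isoD(6)[OF to_interval_iso[of m]] xy m by auto
  have "Zq \<inter> {lo m..real r - lo m} \<inter> {x..y} = Zq \<inter> {x..y}"
    using m by auto
  moreover have "Zq \<inter> {1 / real q ^ Suc m..real r - 1 / real q ^ Suc m} \<inter> {to_interval x..to_interval y}
      = S \<inter> {to_interval x..to_interval y}"
    using sub[of m] in_S by auto
  ultimately show "pl_iso (Zq \<inter> {x..y}) (S \<inter> {to_interval x..to_interval y}) to_interval"
    using pl_iso_interval[OF to_interval_iso[of m], of x y] xy m by simp
qed

lemma BPA_S_iso: "\<exists>h. h \<in> iso (BPA S) (BPA Zq)"
proof -
  have "inv_into Zq to_interval y \<in> Zq \<and> to_interval (inv_into Zq to_interval y) = y" if "y \<in> S" for y
    using that local_isoD(1)[OF local_iso_to_interval] by (metis inv_into_into f_inv_into_f)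
  from conj_iso[OF local_iso_to_interval zconvex_Zq zconvex_S this] show ?thesis
    by blast
qed

end

section \<open>Germs at the end points\<close>

lemma (in group) commute_int_pow:
  assumes "x \<otimes> y = y \<otimes> x" "x \<in> carrier G" "y \<in> carrier G"
  shows "x [^] (i::int) \<otimes> y = y \<otimes> x [^] i"
proof (cases "i < 0")
  case True
  show ?thesis
    using commute_inv[OF group_commutes_pow[OF assms] nat_pow_closed[OF assms(2)] assms(3)]
    by (simp only: int_pow_def2 True if_True)
next
  case False
  show ?thesis
    by (simp only: int_pow_def2 False if_False group_commutes_pow[OF assms])
qed

context interval_line
begin

abbreviation F :: "(real \<Rightarrow> real) monoid" where
  "F \<equiv> PA_group q S"

sublocale F: group F
  by (rule group_PA[OF zconvex_S])

lemma small_in_S: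
  assumes "0 < e"
  shows "\<exists>x\<in>S. x < e"
proof -
  obtain n where n: "1 / real q ^ n < min e (real r)"
    using small_inverse_power[of "min e (real r)"] assms r by auto
  moreover have "0 < 1 / real q ^ n"
    using q_real by simp
  ultimately show ?thesis
    by (intro bexI[of _ "1 / real q ^ n"]) auto
qed

lemma S_nonempty: "S \<noteq> {}"
  using small_in_S[of 1] by fastforce

text \<open>The right germ at 0, described by the exponent of its slope. The behaviour at
  \<open>r\<close> is read off from the germ of \<open>reflect g\<close>.\<close>

definition germ :: "(real \<Rightarrow> real) \<Rightarrow> int \<Rightarrow> bool" where
  "germ g k \<longleftrightarrow> (\<exists>e>0. \<forall>x\<in>S. x < e \<longrightarrow> g x = real q powi k * x)"

text \<open>Before the first positive breaking point the map is affine. A negative constant term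
  would give negative values near 0, and a positive one would keep the values away from 0, contrary
  to surjectivity.\<close>

lemma germ_exists:
  assumes g: "g \<in> carrier F"
  shows "\<exists>k. germ g k"
proof -
  obtain B where B: "finite B" "B \<subseteq> Zq" "\<And>Y. Y \<subseteq> S \<Longrightarrow> sep B Y \<Longrightarrow> affine_map Y g"
    using pl_isoD(3)[of S S g] g unfolding PA_carrier pl_def by blast
  \<comment> \<open>The inserted 1 keeps the minimum defined when \<open>B\<close> has no positive
    point.\<close>
  define e where "e = Min (insert 1 {b \<in> B. 0 < b})"
  have e: "0 < e" "\<And>b. b \<in> B \<Longrightarrow> 0 < b \<Longrightarrow> e \<le> b"
    using B(1) by (auto simp: e_def)
  have "sep B (S \<inter> {..<e})"
    unfolding sep_def using e(2) by force
  then have "affine_map (S \<inter> {..<e}) g"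
    by (rule B(3)[OF Int_lower1])
  then obtain k c where "\<forall>x\<in>S \<inter> {..<e}. g x = real q powi k * x + c"
    unfolding affine_map_def by blast
  then have kc: "g x = real q powi k * x + c" if "x \<in> S" "x < e" for x
    using that by simp
  have P: "0 < real q powi k"
    using q_real by simp
  have "\<not> c < 0"
  proof
    assume "c < 0"
    then have "0 < min e (- c / real q powi k)"
      using e(1) P by (simp add: divide_neg_pos)
    then obtain x where "x \<in> S" "x < min e (- c / real q powi k)"
      using small_in_S by blast
    then have x: "x \<in> S" "x < e" "x < - c / real q powi k"
      by simp_all
    then have "g x < 0"
      using kc[OF x(1,2)] P by (simp add: field_simps)
    then show False
      using PA_closed[OF g x(1)] by simp
  qed
  moreover have "\<not> 0 < c"
  proof
    assume "0 < c"
    obtain x where x: "x \<in> S" "x < e"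
      using small_in_S e(1) by blast
    have gx: "g x \<in> S"
      by (rule PA_closed[OF g x(1)])
    then obtain y where y: "y \<in> S" "y < min c (g x)"
      using small_in_S[of "min c (g x)"] \<open>0 < c\<close> by auto
    then obtain z where z: "z \<in> S" "y = g z"
      using PA_inv(2)[OF zconvex_S g y(1)] PA_closed[OF F.inv_closed[OF g] y(1)] by metis
    then have "z < x"
      using PA_less[OF g z(1) x(1)] y(2) by simp
    then have "y = real q powi k * z + c"
      using kc[OF z(1)] x(2) z(2) by simp
    moreover have "0 < real q powi k * z"
      using P z(1) by (intro mult_pos_pos) auto
    ultimately show False
      using y(2) by simp
  qed
  ultimately have "c = 0" by simp
  then show ?thesis
    unfolding germ_def using kc e(1) by (intro exI[of _ k] exI[of _ e]) auto
qed

lemma germ_mult: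
  assumes f: "f \<in> carrier F" "germ f k" and g: "g \<in> carrier F" "germ g l"
  shows "germ (f \<otimes>\<^bsub>F\<^esub> g) (k + l)"
proof -
  obtain d where d: "0 < d" "\<And>x. x \<in> S \<Longrightarrow> x < d \<Longrightarrow> f x = real q powi k * x"
    using f(2) unfolding germ_def by blast
  obtain e where e: "0 < e" "\<And>x. x \<in> S \<Longrightarrow> x < e \<Longrightarrow> g x = real q powi l * x"
    using g(2) unfolding germ_def by blast
  have P: "0 < real q powi l"
    using q_real by simp
  have "(f \<otimes>\<^bsub>F\<^esub> g) x = real q powi (k + l) * x" if x: "x \<in> S" "x < min e (d / real q powi l)" for x
  proof -
    have gx: "g x = real q powi l * x"
      using e(2) x by simp
    moreover have "real q powi l * x < d"
      using x(2) P by (simp add: less_divide_eq mult.commute)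
    ultimately have "f (g x) = real q powi k * (real q powi l * x)"
      using d(2) PA_closed[OF g(1) x(1)] by metis
    then show ?thesis
      using PA_mult[OF f(1) g(1) x(1)] q_real by (simp add: power_int_add)
  qed
  moreover have "0 < min e (d / real q powi l)"
    using d(1) e(1) P by simp
  ultimately show ?thesis
    unfolding germ_def by blast
qed

lemma germ_one: "germ \<one>\<^bsub>F\<^esub> 0"
  unfolding germ_def using PA_one by (intro exI[of _ 1]) auto

lemma germ_inv:
  assumes g: "g \<in> carrier F" "germ g k"
  shows "germ (inv\<^bsub>F\<^esub> g) (- k)"
proof -
  obtain e where e: "0 < e" "\<And>x. x \<in> S \<Longrightarrow> x < e \<Longrightarrow> g x = real q powi k * x"
    using g(2) unfolding germ_def by blast
  obtain x where x: "x \<in> S" "x < e"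
    using small_in_S e(1) by blast
  have gx: "g x \<in> S"
    by (rule PA_closed[OF g(1) x(1)])
  have P: "real q powi k \<noteq> 0"
    using q_real by simp
  have "(inv\<^bsub>F\<^esub> g) y = real q powi (- k) * y" if y: "y \<in> S" "y < g x" for y
  proof -
    have z: "(inv\<^bsub>F\<^esub> g) y \<in> S" "g ((inv\<^bsub>F\<^esub> g) y) = y"
      using PA_inv(2)[OF zconvex_S g(1) y(1)] PA_closed[OF F.inv_closed[OF g(1)] y(1)] by auto
    then have "(inv\<^bsub>F\<^esub> g) y < x"
      using PA_less[OF g(1) z(1) x(1)] y(2) by simp
    then have "y = real q powi k * (inv\<^bsub>F\<^esub> g) y"
      using e(2)[OF z(1)] x(2) z(2) by simp
    then have "real q powi (- k) * y = (inverse (real q powi k) * real q powi k) * (inv\<^bsub>F\<^esub> g) y"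
      by (metis power_int_minus mult.assoc)
    then show ?thesis
      by (simp only: left_inverse[OF P] mult_1)
  qed
  moreover have "0 < g x"
    using gx by simp
  ultimately show ?thesis
    unfolding germ_def by blast
qed

lemma germ_int_pow:
  assumes g: "g \<in> carrier F" "germ g k"
  shows "germ (g [^]\<^bsub>F\<^esub> (i::int)) (i * k)"
proof -
  have nat: "germ (g [^]\<^bsub>F\<^esub> n) (int n * k)" for n :: nat
  proof (induction n)
    case 0
    then show ?case using germ_one by simp
  next
    case (Suc n)
    then show ?case
      using germ_mult[OF F.nat_pow_closed[OF g(1)] Suc.IH g] by (simp add: algebra_simps)
  qed
  show ?thesis
  proof (cases "i < 0")
    case True
    then have "int (nat (- i)) = - i"
      by simp
    then show ?thesis
      using germ_inv[OF F.nat_pow_closed[OF g(1)] nat[of "nat (- i)"]]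
      by (simp only: int_pow_def2 True if_True minus_mult_left minus_minus)
  next
    case False
    then have "int (nat i) = i"
      by simp
    then show ?thesis
      using nat[of "nat i"] by (simp only: int_pow_def2 False if_False)
  qed
qed

text \<open>Conjugation by the flip of the interval. It exchanges the end points, so the theory of
  germs at 0 also serves at \<open>r\<close>.\<close>

definition reflect :: "(real \<Rightarrow> real) \<Rightarrow> real \<Rightarrow> real" where
  "reflect g = (\<lambda>x\<in>S. real r - g (real r - x))"

lemma S_reflect: "x \<in> S \<Longrightarrow> real r - x \<in> S"
  by (auto intro: Zq_diff)

text \<open>The flip is decreasing and hence no \<open>pl_iso\<close>. It is replaced by increasing
  steps: translate \<open>S\<close> onto its negative, conjugate by negation there, and translate
  back.\<close>

lemma pl_iso_S_reflection:
  assumes "pl_iso S S f"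
  shows "pl_iso S S (\<lambda>x. real r - f (real r - x))"
proof -
  define U where "U = uminus ` S"
  have UZ: "U \<subseteq> Zq"
    by (auto simp: U_def)
  have U: "zconvex U"
    unfolding zconvex_def
  proof (intro conjI UZ ballI impI)
    fix x y z assume "x \<in> U" "y \<in> U" "z \<in> Zq" "x \<le> z" "z \<le> y"
    then have "- z \<in> S"
      by (auto simp: U_def)
    then show "z \<in> U"
      unfolding U_def by (intro image_eqI[of _ _ "- z"]) auto
  qed
  have SU: "(\<lambda>x. x - real r) ` S = U"
  proof
    show "(\<lambda>x. x - real r) ` S \<subseteq> U"
    proof
      fix y assume "y \<in> (\<lambda>x. x - real r) ` S"
      then obtain x where "x \<in> S" "y = - (real r - x)" by auto
      then show "y \<in> U" unfolding U_def using S_reflect by blast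
    qed
    show "U \<subseteq> (\<lambda>x. x - real r) ` S"
    proof
      fix y assume "y \<in> U"
      then obtain x where "x \<in> S" "y = (real r - x) - real r" by (auto simp: U_def)
      then show "y \<in> (\<lambda>x. x - real r) ` S" using S_reflect by blast
    qed
  qed
  then have US: "(\<lambda>x. x + real r) ` U = S"
    by (force simp: image_image)
  have 1: "pl_iso S U (\<lambda>x. x - real r)"
    using SU pl_affine[OF affine_map_translate[of S "- real r"]] by (auto simp: pl_iso_def strict_mono_on_def)
  have 2: "pl_iso U U (\<lambda>x. - f (- x))"
    using pl_iso_reflect[OF assms] by (simp add: U_def)
  have 3: "pl_iso U S (\<lambda>x. x + real r)"
    using US pl_affine[OF affine_map_translate[of U "real r"]] by (auto simp: pl_iso_def strict_mono_on_def)
  have "S \<subseteq> Zq" by simp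
  from pl_iso_comp[OF pl_iso_comp[OF 1 2 this U] 3 this U]
  show ?thesis
    by (simp add: algebra_simps)
qed

lemma reflect_closed: "g \<in> carrier F \<Longrightarrow> reflect g \<in> carrier F"
  unfolding reflect_def by (intro restrict_PA pl_iso_S_reflection) (simp add: PA_carrier)

lemma reflect_apply: "x \<in> S \<Longrightarrow> reflect g x = real r - g (real r - x)"
  by (simp add: reflect_def)

lemma reflect_reflect:
  assumes "g \<in> carrier F"
  shows "reflect (reflect g) = g"
proof (rule PA_eqI[OF reflect_closed[OF reflect_closed[OF assms]] assms])
  fix x assume "x \<in> S"
  then show "reflect (reflect g) x = g x"
    using S_reflect[of x] by (simp add: reflect_apply del: Int_iff)
qed

lemma reflect_mult:
  assumes "f \<in> carrier F" "g \<in> carrier F"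
  shows "reflect (f \<otimes>\<^bsub>F\<^esub> g) = reflect f \<otimes>\<^bsub>F\<^esub> reflect g"
proof (rule PA_eqI)
  show "reflect (f \<otimes>\<^bsub>F\<^esub> g) \<in> carrier F" "reflect f \<otimes>\<^bsub>F\<^esub> reflect g \<in> carrier F"
    using assms reflect_closed by auto
  fix x assume x: "x \<in> S"
  note rx = S_reflect[OF x]
  have gx: "real r - g (real r - x) \<in> S"
    by (rule S_reflect[OF PA_closed[OF assms(2) rx]])
  show "reflect (f \<otimes>\<^bsub>F\<^esub> g) x = (reflect f \<otimes>\<^bsub>F\<^esub> reflect g) x"
    using PA_mult[OF assms rx] PA_mult[OF reflect_closed[OF assms(1)] reflect_closed[OF assms(2)] x]
      reflect_apply[OF x] reflect_apply[OF gx] by simp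
qed

lemma reflect_int_pow:
  assumes "g \<in> carrier F"
  shows "reflect (g [^]\<^bsub>F\<^esub> (i::int)) = reflect g [^]\<^bsub>F\<^esub> i"
proof -
  interpret group_hom F F reflect
    by unfold_locales (auto simp: hom_def reflect_closed reflect_mult)
  show ?thesis
    using assms by (rule hom_int_pow)
qed

lemma germs_bdd:
  assumes g: "g \<in> carrier F" and germ0: "germ g 0" and germ1: "germ (reflect g) 0"
  shows "g \<in> bdd S"
proof -
  obtain d where d: "0 < d" "\<And>x. x \<in> S \<Longrightarrow> x < d \<Longrightarrow> g x = x"
    using germ0 unfolding germ_def by auto
  obtain e where e: "0 < e" "\<And>x. x \<in> S \<Longrightarrow> x < e \<Longrightarrow> reflect g x = x"
    using germ1 unfolding germ_def by auto
  obtain x where x: "x \<in> S" "x < d"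
    using small_in_S d(1) by blast
  obtain y where y: "y \<in> S" "y < e"
    using small_in_S e(1) by blast
  show ?thesis
  proof (rule bddI[OF g x(1) S_reflect[OF y(1)]])
    fix t assume t: "t \<in> S" "t \<le> x \<or> real r - y \<le> t"
    show "g t = t"
    proof (cases "t \<le> x")
      case True
      then show ?thesis using d(2)[OF t(1)] x(2) by simp
    next
      case False
      then have "reflect g (real r - t) = real r - t"
        using t y(2) by (intro e(2) S_reflect) auto
      then show ?thesis
        using reflect_apply[OF S_reflect[OF t(1)], of g] by simp
    qed
  qed
qed

section \<open>Cancelling the germs at both end points\<close>

definition shrink :: "real \<Rightarrow> real \<Rightarrow> real" where
  "shrink c = restrict (bump 0 c) S"

text \<open>The bump ends at \<open>c + c / q\<close>, which is at most \<open>2 * c\<close>. It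
  therefore fixes 0 and \<open>r\<close>, and a monotone bijection of \<open>Zq\<close> fixing both
  preserves the points strictly between them.\<close>

lemma shrink:
  assumes c: "c \<in> Zq" "0 < c" "2 * c < real r"
  shows "shrink c \<in> carrier F" "germ (shrink c) (- 1)" "\<And>x. x \<in> S \<Longrightarrow> 2 * c \<le> x \<Longrightarrow> shrink c x = x"
proof -
  have "c / real q \<le> c"
    using c q_real by (simp add: divide_le_eq)
  then have id: "bump 0 c x = x" if "2 * c \<le> x" for x
    using that by (simp add: bump_def)
  then show "shrink c x = x" if "x \<in> S" "2 * c \<le> x" for x
    using that by (simp add: shrink_def)
  have iso: "pl_iso Zq Zq (bump 0 c)"
    using c by (intro pl_iso_bump) auto
  have "bump 0 c 0 = 0" "bump 0 c (real r) = real r"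
    using c id by (auto simp: bump_def)
  then have iff: "bump 0 c x \<in> S \<longleftrightarrow> x \<in> S" if "x \<in> Zq" for x
    using that pl_isoD(6)[OF iso that] pl_isoD(7)[OF iso, of 0 x] pl_isoD(7)[OF iso, of x "real r"] by auto
  have "bump 0 c ` S = S"
  proof
    show "bump 0 c ` S \<subseteq> S"
    proof
      fix y assume "y \<in> bump 0 c ` S"
      then obtain x where "x \<in> S" "y = bump 0 c x"
        by blast
      then show "y \<in> S"
        using iff[of x] by blast
    qed
    show "S \<subseteq> bump 0 c ` S"
    proof
      fix y assume y: "y \<in> S"
      then obtain x where x: "x \<in> Zq" "y = bump 0 c x"
        using pl_isoD(2)[OF iso] by blast
      then show "y \<in> bump 0 c ` S"
        using iff y by blast
    qed
  qed
  then show "shrink c \<in> carrier F"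
    unfolding shrink_def by (intro restrict_PA pl_iso_subset[OF iso]) auto
  have "shrink c x = real q powi (- 1) * x" if "x \<in> S" "x < c" for x
    using that c by (simp add: shrink_def bump_contract power_int_minus inverse_eq_divide)
  then show "germ (shrink c) (- 1)"
    unfolding germ_def using c(2) by blast
qed

text \<open>\<open>shrink c\<close> has slope 1/q at 0, and its reflection has slope 1/q at
  \<open>r\<close>. The exponents \<open>k\<close> and \<open>l\<close> thus cancel slopes q^k at 0
  and q^l at \<open>r\<close>.\<close>

definition correction :: "real \<Rightarrow> int \<Rightarrow> int \<Rightarrow> real \<Rightarrow> real" where
  "correction c k l = shrink c [^]\<^bsub>F\<^esub> k \<otimes>\<^bsub>F\<^esub> reflect (shrink c) [^]\<^bsub>F\<^esub> l"

lemma correction_factor: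
  assumes c: "c \<in> Zq" "0 < c" "2 * c < real r" and f: "f \<in> carrier F"
  shows "\<exists>k l. f \<otimes>\<^bsub>F\<^esub> correction c k l \<in> bdd S"
proof -
  note s = shrink[OF c]
  note t = reflect_closed[OF s(1)]
  have germ_id: "germ (reflect (shrink c)) 0"
    unfolding germ_def
  proof (intro exI[of _ "real r - 2 * c"] conjI ballI impI)
    show "0 < real r - 2 * c"
      using c by simp
    fix x assume x: "x \<in> S" "x < real r - 2 * c"
    then have "shrink c (real r - x) = real r - x"
      by (intro s(3) S_reflect) auto
    then show "reflect (shrink c) x = real q powi 0 * x"
      using reflect_apply[OF x(1)] by simp
  qed
  obtain k where k: "germ f k"
    using germ_exists f by blast
  obtain l where l: "germ (reflect f) l"
    using germ_exists reflect_closed f by blast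
  have cor: "correction c k l \<in> carrier F"
    using s(1) t by (simp add: correction_def)
  have "germ (correction c k l) (k * - 1 + l * 0)"
    unfolding correction_def using s(1,2) t germ_id by (intro germ_mult germ_int_pow) auto
  then have 0: "germ (f \<otimes>\<^bsub>F\<^esub> correction c k l) 0"
    using germ_mult[OF f k cor, of "- k"] by simp
  have "reflect (correction c k l) = reflect (shrink c) [^]\<^bsub>F\<^esub> k \<otimes>\<^bsub>F\<^esub> shrink c [^]\<^bsub>F\<^esub> l"
    unfolding correction_def using s(1) t
    by (simp add: reflect_mult reflect_int_pow reflect_reflect)
  moreover have "germ (reflect (shrink c) [^]\<^bsub>F\<^esub> k \<otimes>\<^bsub>F\<^esub> shrink c [^]\<^bsub>F\<^esub> l) (k * 0 + l * - 1)"
    using s(1,2) t germ_id by (intro germ_mult germ_int_pow) auto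
  ultimately have "germ (reflect (f \<otimes>\<^bsub>F\<^esub> correction c k l)) 0"
    using germ_mult[OF reflect_closed[OF f] l reflect_closed[OF cor], of "- l"] reflect_mult[OF f cor] by simp
  then show ?thesis
    using germs_bdd[OF _ 0] f cor by auto
qed

lemma fixes_int_pow:
  assumes g: "g \<in> carrier F" and x: "x \<in> S" "g x = x"
  shows "(g [^]\<^bsub>F\<^esub> (i::int)) x = x"
proof -
  have nat: "(g [^]\<^bsub>F\<^esub> n) x = x" for n :: nat
  proof (induction n)
    case 0
    then show ?case using PA_one[OF x(1)] by simp
  next
    case (Suc n)
    then show ?case
      using PA_mult[OF F.nat_pow_closed[OF g] g x(1)] x(2) by simp
  qed
  then have "(inv\<^bsub>F\<^esub> (g [^]\<^bsub>F\<^esub> n)) x = x" for n :: nat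
    using PA_inv(1)[OF zconvex_S F.nat_pow_closed[OF g] x(1), of n] by (simp only:)
  with nat show ?thesis
    unfolding int_pow_def2 by (cases "i < 0") (simp_all only: if_True if_False)
qed

lemma correction_fixes:
  assumes c: "c \<in> Zq" "0 < c" "2 * c < real r" and x: "x \<in> S" "2 * c \<le> x" "x \<le> real r - 2 * c"
  shows "correction c k l x = x"
proof -
  note s = shrink[OF c]
  have "shrink c x = x"
    using s(3) x by blast
  moreover have "shrink c (real r - x) = real r - x"
    using x by (intro s(3) S_reflect) auto
  then have "reflect (shrink c) x = x"
    using reflect_apply[OF x(1)] by simp
  ultimately show ?thesis
    unfolding correction_def
    using PA_mult[OF F.int_pow_closed[OF s(1)] F.int_pow_closed[OF reflect_closed[OF s(1)]] x(1)]
      fixes_int_pow[OF s(1) x(1)] fixes_int_pow[OF reflect_closed[OF s(1)] x(1)] by simp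
qed

text \<open>The counterpart of \<open>rist_commute\<close> for elements whose support reaches the
  end points. Both maps fix \<open>x\<close> and \<open>y\<close>, hence preserve the interval
  between them and its complement, and on each of these sets one of the maps is the
  identity.\<close>

lemma commute_if_disjoint:
  assumes f: "f \<in> carrier F" and g: "g \<in> carrier F" and xy: "x \<in> S" "y \<in> S"
    and f_id: "\<And>t. t \<in> S \<Longrightarrow> t \<le> x \<or> y \<le> t \<Longrightarrow> f t = t"
    and g_id: "\<And>t. t \<in> S \<Longrightarrow> x \<le> t \<Longrightarrow> t \<le> y \<Longrightarrow> g t = t" and le: "x \<le> y"
  shows "f \<otimes>\<^bsub>F\<^esub> g = g \<otimes>\<^bsub>F\<^esub> f"
proof (rule PA_eqI[OF F.m_closed[OF f g] F.m_closed[OF g f]])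
  fix t assume t: "t \<in> S"
  have fix_f: "f x = x" "f y = y" and fix_g: "g x = x" "g y = y"
    using f_id g_id xy le by auto
  have "f (g t) = g (f t)"
  proof (cases "t \<le> x \<or> y \<le> t")
    case True
    then have "g t \<le> x \<or> y \<le> g t"
      using PA_le[OF g t xy(1)] PA_le[OF g xy(2) t] fix_g by auto
    then show ?thesis
      using True f_id t PA_closed[OF g t] by simp
  next
    case False
    then have "x \<le> f t" "f t \<le> y"
      using PA_le[OF f xy(1) t] PA_le[OF f t xy(2)] fix_f by auto
    then show ?thesis
      using False g_id t PA_closed[OF f t] by simp
  qed
  then show "(f \<otimes>\<^bsub>F\<^esub> g) t = (g \<otimes>\<^bsub>F\<^esub> f) t"
    using PA_mult[OF f g t] PA_mult[OF g f t] by simp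
qed

text \<open>With \<open>4 * c\<close> below \<open>r\<close> the two supports are separated by the
  point \<open>2 * c\<close>, which both maps fix.\<close>

lemma shrink_commutes_reflect:
  assumes c: "c \<in> Zq" "0 < c" "4 * c < real r"
  shows "shrink c \<otimes>\<^bsub>F\<^esub> reflect (shrink c) = reflect (shrink c) \<otimes>\<^bsub>F\<^esub> shrink c"
proof -
  have c2: "2 * c < real r"
    using c by simp
  note s = shrink[OF c(1,2) c2]
  note t = reflect_closed[OF s(1)]
  have t_id: "reflect (shrink c) x = x" if "x \<in> S" "x \<le> real r - 2 * c" for x
  proof -
    have "shrink c (real r - x) = real r - x"
      using that by (intro s(3) S_reflect) auto
    then show ?thesis
      using reflect_apply[OF that(1)] by simp
  qed
  show ?thesis
  proof (rule PA_eqI[OF F.m_closed[OF s(1) t] F.m_closed[OF t s(1)]])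
    fix x assume x: "x \<in> S"
    define m where "m = 2 * c"
    have m: "m \<in> S" "shrink c m = m"
    proof -
      have "m \<in> Zq"
        unfolding m_def using c Zq_consts(3)[of 2] by (intro Zq_mult) auto
      then show "m \<in> S"
        using c c2 by (simp add: m_def)
      then show "shrink c m = m"
        using s(3) by (simp add: m_def)
    qed
    have tm: "reflect (shrink c) m = m"
      using t_id m c by (simp add: m_def)
    have "shrink c (reflect (shrink c) x) = reflect (shrink c) (shrink c x)"
    proof (cases "x \<le> m")
      case True
      then have "shrink c x \<le> m"
        using PA_le[OF s(1) x m(1)] m(2) by simp
      then show ?thesis
        using True t_id x c PA_closed[OF s(1) x] by (simp add: m_def del: Int_iff)
    next
      case False
      then have "m \<le> reflect (shrink c) x"
        using PA_le[OF t m(1) x] tm by simp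
      then show ?thesis
        using False s(3) x PA_closed[OF t x] by (simp add: m_def del: Int_iff)
    qed
    then show "(shrink c \<otimes>\<^bsub>F\<^esub> reflect (shrink c)) x = (reflect (shrink c) \<otimes>\<^bsub>F\<^esub> shrink c) x"
      using PA_mult[OF s(1) t x] PA_mult[OF t s(1) x] by simp
  qed
qed

text \<open>Corrections are used at two scales. One fixed \<open>c\<close> below
  \<open>r / 4\<close> makes all corrections commute with one another and gives the commutative
  factor \<open>H\<close>. For a given \<open>b\<close> a much smaller \<open>d\<close> is chosen,
  so that the correction is the identity on the interval containing the support of \<open>b\<close>
  and commutes with \<open>b\<close>.\<close>

lemma derived_F: "derived F (carrier F) = derived F (bdd S)"
proof -
  obtain c where c: "c \<in> Zq" "0 < c" "c < real r / 4"
    using small_in_S[of "real r / 4"] r by auto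
  have c24: "2 * c < real r" "4 * c < real r"
    using c by auto
  note s = shrink[OF c(1,2) c24(1)]
  note t = reflect_closed[OF s(1)]
  note st = shrink_commutes_reflect[OF c(1,2) c24(2)]
  define H where "H = {correction c k l | k l. True}"
  have comm_pow: "shrink c [^]\<^bsub>F\<^esub> (i::int) \<otimes>\<^bsub>F\<^esub> reflect (shrink c) [^]\<^bsub>F\<^esub> (j::int)
      = reflect (shrink c) [^]\<^bsub>F\<^esub> j \<otimes>\<^bsub>F\<^esub> shrink c [^]\<^bsub>F\<^esub> i" for i j
    using F.commute_int_pow[OF F.commute_int_pow[OF st s(1) t, symmetric] t] s(1) by simp
  have mult: "correction c k l \<otimes>\<^bsub>F\<^esub> correction c k' l' = correction c (k + k') (l + l')" for k l k' l'
  proof -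
    have "correction c k l \<otimes>\<^bsub>F\<^esub> correction c k' l' = shrink c [^]\<^bsub>F\<^esub> k \<otimes>\<^bsub>F\<^esub>
        (reflect (shrink c) [^]\<^bsub>F\<^esub> l \<otimes>\<^bsub>F\<^esub> shrink c [^]\<^bsub>F\<^esub> k') \<otimes>\<^bsub>F\<^esub> reflect (shrink c) [^]\<^bsub>F\<^esub> l'"
      unfolding correction_def using s(1) t by (simp add: F.m_assoc)
    also have "\<dots> = (shrink c [^]\<^bsub>F\<^esub> k \<otimes>\<^bsub>F\<^esub> shrink c [^]\<^bsub>F\<^esub> k') \<otimes>\<^bsub>F\<^esub>
        (reflect (shrink c) [^]\<^bsub>F\<^esub> l \<otimes>\<^bsub>F\<^esub> reflect (shrink c) [^]\<^bsub>F\<^esub> l')"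
      unfolding comm_pow[symmetric] using s(1) t by (simp add: F.m_assoc)
    finally show ?thesis
      unfolding correction_def using s(1) t by (simp add: F.int_pow_mult)
  qed
  show ?thesis
  proof (rule F.derived_eq_derived_subgroup[OF subgroup_bdd[OF zconvex_S S_nonempty], of H])
    show "H \<subseteq> carrier F"
      using s(1) t by (auto simp: H_def correction_def)
    show "h \<otimes>\<^bsub>F\<^esub> k = k \<otimes>\<^bsub>F\<^esub> h" if "h \<in> H" "k \<in> H" for h k
      using that mult by (auto simp: H_def add.commute)
    show "\<exists>h\<in>H. f \<otimes>\<^bsub>F\<^esub> h \<in> bdd S" if "f \<in> carrier F" for f
      using correction_factor[OF c(1,2) c24(1) that] by (auto simp: H_def)
    fix f b assume f: "f \<in> carrier F" and b: "b \<in> bdd S"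
    obtain x y where xy: "x \<in> S" "y \<in> S" "x \<le> y" "\<And>t. t \<in> S \<Longrightarrow> t \<le> x \<or> y \<le> t \<Longrightarrow> b t = t"
      using bddE[OF b] by metis
    obtain d where d: "d \<in> S" "d < min (x / 2) ((real r - y) / 2)"
      using small_in_S[of "min (x / 2) ((real r - y) / 2)"] xy by auto
    then have d': "d \<in> Zq" "0 < d" "2 * d < real r" "2 * d \<le> x" "y \<le> real r - 2 * d"
      using xy by auto
    obtain k l where kl: "f \<otimes>\<^bsub>F\<^esub> correction d k l \<in> bdd S"
      using correction_factor[OF d'(1-3) f] by blast
    have cor: "correction d k l \<in> carrier F"
      using shrink(1)[OF d'(1-3)] reflect_closed by (simp add: correction_def)
    have "correction d k l t = t" if "t \<in> S" "x \<le> t" "t \<le> y" for t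
      using that d' by (intro correction_fixes) auto
    then have "b \<otimes>\<^bsub>F\<^esub> correction d k l = correction d k l \<otimes>\<^bsub>F\<^esub> b"
      using xy by (intro commute_if_disjoint[OF bdd_carrier[OF b] cor xy(1,2)]) auto
    then show "\<exists>h\<in>carrier F. h \<otimes>\<^bsub>F\<^esub> b = b \<otimes>\<^bsub>F\<^esub> h \<and> f \<otimes>\<^bsub>F\<^esub> h \<in> bdd S"
      using cor kl by metis
  qed
qed

lemma commutator_subgroup_F: "commutator_subgroup F = commutator_subgroup (BPA S)"
  using derived_F F.derived_consistent[OF order.refl subgroup_bdd[OF zconvex_S S_nonempty]]
  by (simp add: commutator_subgroup_def)

end

theorem corollary3p4:
  fixes q r :: nat
  assumes "q > r" and "r \<ge> 1"
  shows "commutator_subgroup (F_interval q r) \<cong> commutator_subgroup (BF q)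
       \<and> uniformly_simple 6 (commutator_subgroup (F_interval q r))
       \<and> commutator_width (commutator_subgroup (F_interval q r)) \<le> 2"
proof -
  interpret interval_line q r
    by unfold_locales (use assms in auto)
  have F: "F_interval q r = F"
    by (simp add: F_interval_def)
  have groups: "group (BPA S)" "group (BPA Zq)"
    using group_BPA[OF zconvex_S S_nonempty] group_BPA[OF zconvex_Zq] Zq_consts by blast+
  obtain h where h: "h \<in> iso (BPA S) (BPA Zq)"
    using BPA_S_iso by blast
  interpret A: proximal_action "BPA S" Zq "\<lambda>g. h g"
    by (rule proximal_action_pullback[OF proximal_action_BPA_Zq groups(1) h])
  show ?thesis
    unfolding F commutator_subgroup_F BF_eq
    using commutator_subgroup_iso[OF groups h] A.commutator_subgroup_uniformly_simple
      A.commutator_width_commutator_subgroup by blast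
qed

end
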